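(* Fix a designer action strategy $h^0\in\mathcal G^0$ and an agent strategy $h^1\in\mathcal G^1$, and let $g^m\in\mathcal G^m$ be an arbitrary designer messaging strategy. For each $t$ and $c_t\in\mathcal C_t$ define $$\eta_t(x_t,p^{0}_t,p^1_t,m^1_t,n_t|c_t)=Q_t(n_t)\,\pi_t(x_t,p^{0}_t,p^1_t|c_t)\,g^m_t(m^1_t|p^0_t,c_t),$$ and define recursively $W^1_{T+1}:=0$ and, for $t=T,\dots,1$, $$W^1_t(c_t)=\sum_{x,p^0,p^1,m^1,n}\eta_t(x,p^0,p^1,m^1,n|c_t)\left[r^1_t(x,u^0_t,u^1_t)+W^1_{t+1}(c_t,z_{t+1})\right],$$ where $u^0_t=h^0_t(p^0,c_t)$, $u^1_t=h^1_t(m^1,p^1,c_t)$, $z_{t+1}=\zeta_{t+1}(x,p^0,p^1,u^0_t,u^1_t,n)$. Then $h^1$ satisfies $CISR(g^m,h^0)$ if and only if for all $t=1,\dots,T$, all $c_t\in\mathcal C_t$, $m^1_t\in\mathcal M^1_t$, $p^1_t\in\mathcal P^1_t$, and all $u\in\mathcal U^1_t$, $$\sum_{x,p^0,n}\eta_t(x,p^0,p^1_t,m^1_t,n|c_t)\left[r^1_t(x,u^0_t,u^1_t)+W^1_{t+1}(c_t,z_{t+1})\right]\ \ge\ \sum_{x,p^0,n}\eta_t(x,p^0,p^1_t,m^1_t,n|c_t)\left[r^1_t(x,u^0_t,u)+W^1_{t+1}(c_t,\tilde z_{t+1})\right],$$ where $u^0_t=h^0_t(p^0,c_t)$, $u^1_t=h^1_t(m^1_t,p^1_t,c_t)$,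 $z_{t+1}=\zeta_{t+1}(x,p^0,p^1_t,u^0_t,u^1_t,n)$, $\tilde z_{t+1}=\zeta_{t+1}(x,p^0,p^1_t,u^0_t,u,n)$, and sums range over $x\in\mathcal X_t$, $p^0\in\mathcal P^0_t$, $n\in\mathcal N_t$ (and $p^1\in\mathcal P^1_t$, $m^1\in\mathcal M^1_t$ where present).
   Context: Model (one designer, one agent, horizon $T$, $t=1,\dots,T$; all sets finite). State $X_t\in\mathcal X_t$, designer action $U^0_t\in\mathcal U^0_t$, agent action $U^1_t\in\mathcal U^1_t$, noise $N_t\in\mathcal N_t$, message $M^1_t\in\mathcal M^1_t$. Dynamics $X_{t+1}=f_t(X_t,U^0_t,U^1_t,N_t)$. $X_1,N_1,\dots,N_T$ are mutually independent, $X_1\sim P_{X_1}$, $N_t\sim Q_t$. Information: $C_t$ is common information (known to designer and agent), $P^0_t\in\mathcal P^0_t$ is the designer's private information, $P^1_t\in\mathcal P^1_t$ the agent's private information. Assumption 1: $P^i_{t+1}=\xi^i_{t+1}(X_t,P^i_t,U^0_t,U^1_t,N_t)$ for $i=0,1$; $C_{t+1}=(C_t,Z_{t+1})$ with $Z_{t+1}=\zeta_{t+1}(X_t,P^0_t,P^1_t,U^0_t,U^1_t,N_t)$; $\xi^i_{t+1},\zeta_{t+1}$ are fixed functions; at $t=1$, $(P^0_1,P^1_1,C_1)$ is generated based on $X_1$ and $N_1$ according to a given conditional distribution $\Lambda(p^0_1,p^1_1,c_1|x_1,n_1)$. Strategies: a messaging strategy $g^m=(g^m_1,\dots,g^m_T)\in\mathcal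 G^m$ assigns to each $(p^0_t,c_t)$ a probability distribution $g^m_t(\cdot|p^0_t,c_t)$ on $\mathcal M^1_t$, from which $M^1_t$ is randomly drawn when $P^0_t=p^0_t,C_t=c_t$. A designer action strategy $g^0\in\mathcal G^0$ consists of functions with $U^0_t=g^0_t(P^0_t,C_t)$. An agent strategy $g^1\in\mathcal G^1$ consists of functions with $U^1_t=g^1_t(M^1_t,P^1_t,C_t)$. A strategy profile is $g=(g^m,g^0,g^1)$. The agent's reward at time $t$ is $r^1_t(X_t,U^0_t,U^1_t)$. $\mathcal C_t$ denotes the set of possible realizations of $C_t$, i.e. those with positive probability under some strategy profile. Assumption 2 (strategy-independent beliefs): if $c_t$ has positive probability under profiles $g$ and $\tilde g$, then $\mathbb P^g(X_t=\cdot,P^0_t=\cdot,P^1_t=\cdot|c_t)=\mathbb P^{\tilde g}(X_t=\cdot,P^0_t=\cdot,P^1_t=\cdot|c_t)$; this common value is denoted $\pi_t(x,p^0,p^1|c_t)$. CISR: "$h^1$ satisfies $CISR(g^m,h^0)$" (common information based sequential rationality) means that for each $t$, each $c_t\in\mathcal C_t$ and each $g^1\in\mathcal G^1$, $$\mathbb E^{(g^m,h^0,h^1)_{t:T}}\Big[\sum_{k=t}^T r^1_k(X_k,U^0_k,U^1_k)\Big|c_t\Big]\ge \mathbb E^{(g^m,h^0,g^1)_{t:T}}\Big[\sum_{k=t}^T r^1_k(X_k,U^0_k,U^1_k)\Big|c_t\Big],$$ where each expectation is computed with $C_t=c_t$, $(X_t,P^0_t,P^1_t)\sim\pi_t(\cdot|c_t)$,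 noises $N_k\sim Q_k$ ($k\ge t$) independent, and all subsequent variables generated using the indicated strategies from time $t$ to $T$. Convention: in sums weighted by $\eta_t$, terms with weight $0$ count as $0$.
   Formalization: Added assumption (the claim fails without it): if T>1, then given (X_1,P^0_1,P^1_1,C_1) and any actions, the law of (X_2,P^0_2,P^1_2,Z_2) is the one computed with N_1 ~ Q_1 drawn afresh; e.g. this holds if Λ does not depend on n_1. *)

theory Defs
  imports "HOL-Probability.Probability"
begin

(* Common information: C_1 is primitive and C_(t+1) = (C_t, Z_(t+1)). *)
datatype ('c, 'z) cinfo = Init 'c | Ext "('c, 'z) cinfo" 'z

(* Time runs from 1 to horizon.  The fields dpriv_upd, apriv_upd and incr_upd are the functions
   xi^0, xi^1 and zeta; they carry the index of the variable they produce, whereas dyn carries the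
   index of the current state: X_(t+1) = dyn t ..., P^0_(t+1) = dpriv_upd (t+1) .... *)
record ('x, 'u0, 'u1, 'n, 'm, 'p0, 'p1, 'c, 'z) problem =
  horizon :: nat
  states :: "nat \<Rightarrow> 'x set"
  dacts :: "nat \<Rightarrow> 'u0 set"
  aacts :: "nat \<Rightarrow> 'u1 set"
  noises :: "nat \<Rightarrow> 'n set"
  msgs :: "nat \<Rightarrow> 'm set"
  dprivs :: "nat \<Rightarrow> 'p0 set"
  aprivs :: "nat \<Rightarrow> 'p1 set"
  init_commons :: "'c set"
  incrs :: "nat \<Rightarrow> 'z set"
  state_law :: "'x pmf"
  noise_law :: "nat \<Rightarrow> 'n pmf"
  info_law :: "'x \<Rightarrow> 'n \<Rightarrow> ('p0 \<times> 'p1 \<times> 'c) pmf"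
  dyn :: "nat \<Rightarrow> 'x \<Rightarrow> 'u0 \<Rightarrow> 'u1 \<Rightarrow> 'n \<Rightarrow> 'x"
  dpriv_upd :: "nat \<Rightarrow> 'x \<Rightarrow> 'p0 \<Rightarrow> 'u0 \<Rightarrow> 'u1 \<Rightarrow> 'n \<Rightarrow> 'p0"
  apriv_upd :: "nat \<Rightarrow> 'x \<Rightarrow> 'p1 \<Rightarrow> 'u0 \<Rightarrow> 'u1 \<Rightarrow> 'n \<Rightarrow> 'p1"
  incr_upd :: "nat \<Rightarrow> 'x \<Rightarrow> 'p0 \<Rightarrow> 'p1 \<Rightarrow> 'u0 \<Rightarrow> 'u1 \<Rightarrow> 'n \<Rightarrow> 'z"
  reward :: "nat \<Rightarrow> 'x \<Rightarrow> 'u0 \<Rightarrow> 'u1 \<Rightarrow> real"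

definition wf_problem :: "('x, 'u0, 'u1, 'n, 'm, 'p0, 'p1, 'c, 'z) problem \<Rightarrow> bool" where
  "wf_problem D \<longleftrightarrow>
     1 \<le> horizon D \<and>
     (\<forall>t\<in>{1..horizon D}.
        finite (states D t) \<and> finite (dacts D t) \<and> finite (aacts D t) \<and> finite (noises D t) \<and>
        finite (msgs D t) \<and> finite (dprivs D t) \<and> finite (aprivs D t) \<and>
        set_pmf (noise_law D t) \<subseteq> noises D t) \<and>
     finite (init_commons D) \<and> (\<forall>t\<in>{2..horizon D}. finite (incrs D t)) \<and>
     set_pmf (state_law D) \<subseteq> states D 1 \<and>
     (\<forall>x\<in>states D 1. \<forall>n\<in>noises D 1.
        set_pmf (info_law D x n) \<subseteq> dprivs D 1 \<times> aprivs D 1 \<times> init_commons D) \<and>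
     (\<forall>t\<in>{1..<horizon D}. \<forall>x\<in>states D t. \<forall>p0\<in>dprivs D t. \<forall>p1\<in>aprivs D t.
      \<forall>u0\<in>dacts D t. \<forall>u1\<in>aacts D t. \<forall>n\<in>noises D t.
        dyn D t x u0 u1 n \<in> states D (Suc t) \<and>
        dpriv_upd D (Suc t) x p0 u0 u1 n \<in> dprivs D (Suc t) \<and>
        apriv_upd D (Suc t) x p1 u0 u1 n \<in> aprivs D (Suc t) \<and>
        incr_upd D (Suc t) x p0 p1 u0 u1 n \<in> incrs D (Suc t))"

(* All formal values of C_t, whether or not they occur with positive probability. *)
fun commons ::
  "('x, 'u0, 'u1, 'n, 'm, 'p0, 'p1, 'c, 'z) problem \<Rightarrow> nat \<Rightarrow> ('c, 'z) cinfo set" where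
  "commons D 0 = {}"
| "commons D (Suc 0) = Init ` init_commons D"
| "commons D (Suc (Suc t)) = {Ext c z | c z. c \<in> commons D (Suc t) \<and> z \<in> incrs D (Suc (Suc t))}"

type_synonym ('m, 'p0, 'c, 'z) mstrategy = "nat \<Rightarrow> 'p0 \<Rightarrow> ('c, 'z) cinfo \<Rightarrow> 'm pmf"
type_synonym ('u0, 'p0, 'c, 'z) dstrategy = "nat \<Rightarrow> 'p0 \<Rightarrow> ('c, 'z) cinfo \<Rightarrow> 'u0"
type_synonym ('u1, 'm, 'p1, 'c, 'z) astrategy = "nat \<Rightarrow> 'm \<Rightarrow> 'p1 \<Rightarrow> ('c, 'z) cinfo \<Rightarrow> 'u1"
type_synonym ('u0, 'u1, 'm, 'p0, 'p1, 'c, 'z) profile =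
  "('m, 'p0, 'c, 'z) mstrategy \<times> ('u0, 'p0, 'c, 'z) dstrategy \<times> ('u1, 'm, 'p1, 'c, 'z) astrategy"

definition mstrategies ::
  "('x, 'u0, 'u1, 'n, 'm, 'p0, 'p1, 'c, 'z) problem \<Rightarrow> ('m, 'p0, 'c, 'z) mstrategy set" where
  "mstrategies D = {gm. \<forall>t\<in>{1..horizon D}. \<forall>p0\<in>dprivs D t. \<forall>c\<in>commons D t.
     set_pmf (gm t p0 c) \<subseteq> msgs D t}"

definition dstrategies ::
  "('x, 'u0, 'u1, 'n, 'm, 'p0, 'p1, 'c, 'z) problem \<Rightarrow> ('u0, 'p0, 'c, 'z) dstrategy set" where
  "dstrategies D = {g0. \<forall>t\<in>{1..horizon D}. \<forall>p0\<in>dprivs D t. \<forall>c\<in>commons D t.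
     g0 t p0 c \<in> dacts D t}"

definition astrategies ::
  "('x, 'u0, 'u1, 'n, 'm, 'p0, 'p1, 'c, 'z) problem \<Rightarrow> ('u1, 'm, 'p1, 'c, 'z) astrategy set" where
  "astrategies D = {g1. \<forall>t\<in>{1..horizon D}. \<forall>m\<in>msgs D t. \<forall>p1\<in>aprivs D t. \<forall>c\<in>commons D t.
     g1 t m p1 c \<in> aacts D t}"

definition profiles ::
  "('x, 'u0, 'u1, 'n, 'm, 'p0, 'p1, 'c, 'z) problem \<Rightarrow>
   ('u0, 'u1, 'm, 'p0, 'p1, 'c, 'z) profile set" where
  "profiles D = mstrategies D \<times> dstrategies D \<times> astrategies D"

record ('x, 'u0, 'u1, 'm, 'p0, 'p1, 'c, 'z) stage =
  X :: 'x
  P0 :: 'p0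
  P1 :: 'p1
  C :: "('c, 'z) cinfo"
  M1 :: 'm
  U0 :: 'u0
  U1 :: 'u1

(* The law of the trajectory over the k stages t, ..., t+k-1, started at time t in (x, p0, p1, c),
   with the noises fixed to be the sequence ns; only the messages are random.  A trajectory maps a
   time to the variables of that time and is undefined outside the simulated stages. *)
primrec run ::
  "('x, 'u0, 'u1, 'n, 'm, 'p0, 'p1, 'c, 'z) problem \<Rightarrow>
   ('u0, 'u1, 'm, 'p0, 'p1, 'c, 'z) profile \<Rightarrow> (nat \<Rightarrow> 'n) \<Rightarrow> nat \<Rightarrow> nat \<Rightarrow>
   'x \<Rightarrow> 'p0 \<Rightarrow> 'p1 \<Rightarrow> ('c, 'z) cinfo \<Rightarrow>
   (nat \<Rightarrow> ('x, 'u0, 'u1, 'm, 'p0, 'p1, 'c, 'z) stage) pmf" where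
  "run D g ns 0 t x p0 p1 c = return_pmf (\<lambda>_. undefined)"
| "run D g ns (Suc k) t x p0 p1 c =
     (case g of (gm, g0, g1) \<Rightarrow>
       do {
         m \<leftarrow> gm t p0 c;
         let u0 = g0 t p0 c;
         let u1 = g1 t m p1 c;
         w \<leftarrow> run D g ns k (Suc t)
               (dyn D t x u0 u1 (ns t))
               (dpriv_upd D (Suc t) x p0 u0 u1 (ns t))
               (apriv_upd D (Suc t) x p1 u0 u1 (ns t))
               (Ext c (incr_upd D (Suc t) x p0 p1 u0 u1 (ns t)));
         return_pmf (w(t := \<lparr>X = x, P0 = p0, P1 = p1, C = c, M1 = m, U0 = u0, U1 = u1\<rparr>))
       })"

(* The measure P^g: one and the same N_1 = ns 1 enters the initial information and the first
   transition. *)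
definition law ::
  "('x, 'u0, 'u1, 'n, 'm, 'p0, 'p1, 'c, 'z) problem \<Rightarrow>
   ('u0, 'u1, 'm, 'p0, 'p1, 'c, 'z) profile \<Rightarrow>
   (nat \<Rightarrow> ('x, 'u0, 'u1, 'm, 'p0, 'p1, 'c, 'z) stage) pmf" where
  "law D g =
     do {
       x \<leftarrow> state_law D;
       ns \<leftarrow> Pi_pmf {1..horizon D} undefined (noise_law D);
       (p0, p1, c) \<leftarrow> info_law D x (ns 1);
       run D g ns (horizon D) 1 x p0 p1 (Init c)
     }"

definition common_event ::
  "nat \<Rightarrow> ('c, 'z) cinfo \<Rightarrow> (nat \<Rightarrow> ('x, 'u0, 'u1, 'm, 'p0, 'p1, 'c, 'z) stage) set" where
  "common_event t c = {w. C (w t) = c}"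

definition possible_under ::
  "('x, 'u0, 'u1, 'n, 'm, 'p0, 'p1, 'c, 'z) problem \<Rightarrow>
   ('u0, 'u1, 'm, 'p0, 'p1, 'c, 'z) profile \<Rightarrow> nat \<Rightarrow> ('c, 'z) cinfo \<Rightarrow> bool" where
  "possible_under D g t c \<longleftrightarrow> measure_pmf.prob (law D g) (common_event t c) > 0"

definition possible_commons ::
  "('x, 'u0, 'u1, 'n, 'm, 'p0, 'p1, 'c, 'z) problem \<Rightarrow> nat \<Rightarrow> ('c, 'z) cinfo set" where
  "possible_commons D t = {c. \<exists>g\<in>profiles D. possible_under D g t c}"

(* P^g(X_t = ., P^0_t = ., P^1_t = . | c_t); meaningful only if c is possible under g at t. *)
definition belief_under ::
  "('x, 'u0, 'u1, 'n, 'm, 'p0, 'p1, 'c, 'z) problem \<Rightarrow>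
   ('u0, 'u1, 'm, 'p0, 'p1, 'c, 'z) profile \<Rightarrow> nat \<Rightarrow> ('c, 'z) cinfo \<Rightarrow>
   ('x \<times> 'p0 \<times> 'p1) pmf" where
  "belief_under D g t c =
     map_pmf (\<lambda>w. (X (w t), P0 (w t), P1 (w t))) (cond_pmf (law D g) (common_event t c))"

definition strategy_independent_beliefs ::
  "('x, 'u0, 'u1, 'n, 'm, 'p0, 'p1, 'c, 'z) problem \<Rightarrow> bool" where
  "strategy_independent_beliefs D \<longleftrightarrow>
     (\<forall>t\<in>{1..horizon D}. \<forall>c. \<forall>g\<in>profiles D. \<forall>g'\<in>profiles D.
        possible_under D g t c \<longrightarrow> possible_under D g' t c \<longrightarrow>
        belief_under D g t c = belief_under D g' t c)"

(* The common value pi_t( . | c_t); an arbitrary distribution if c is not possible at t. *)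
definition belief ::
  "('x, 'u0, 'u1, 'n, 'm, 'p0, 'p1, 'c, 'z) problem \<Rightarrow> nat \<Rightarrow> ('c, 'z) cinfo \<Rightarrow>
   ('x \<times> 'p0 \<times> 'p1) pmf" where
  "belief D t c =
     (THE \<mu>. \<exists>g\<in>profiles D. possible_under D g t c \<and> \<mu> = belief_under D g t c)"

(* Below, the future from time t on given C_t is computed with N_t distributed as Q_t independently
   of (X_t, P^0_t, P^1_t, C_t).  Under P^g this holds automatically for t > 1, but not for t = 1,
   because the initial information may depend on N_1.  The following condition says that observing
   (X_1, P^0_1, P^1_1, C_1) does not change the law of the transition which N_1 drives; N_1 itself
   need not be independent of the initial information. *)
definition initial_noise_consistent ::
  "('x, 'u0, 'u1, 'n, 'm, 'p0, 'p1, 'c, 'z) problem \<Rightarrow> bool" where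
  "initial_noise_consistent D \<longleftrightarrow>
     (let init = do {
          x \<leftarrow> state_law D;
          n \<leftarrow> noise_law D 1;
          (p0, p1, c) \<leftarrow> info_law D x n;
          return_pmf ((x, p0, p1, c), n)
        }
      in horizon D > 1 \<longrightarrow>
        (\<forall>(x, p0, p1, c) \<in> fst ` set_pmf init. \<forall>u0\<in>dacts D 1. \<forall>u1\<in>aacts D 1.
          let step = (\<lambda>n. (dyn D 1 x u0 u1 n, dpriv_upd D 2 x p0 u0 u1 n,
                          apriv_upd D 2 x p1 u0 u1 n, incr_upd D 2 x p0 p1 u0 u1 n))
          in map_pmf (\<lambda>(_, n). step n) (cond_pmf init {i. fst i = (x, p0, p1, c)}) =
             map_pmf step (noise_law D 1)))"

definition continuation_law ::
  "('x, 'u0, 'u1, 'n, 'm, 'p0, 'p1, 'c, 'z) problem \<Rightarrow>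
   ('u0, 'u1, 'm, 'p0, 'p1, 'c, 'z) profile \<Rightarrow> nat \<Rightarrow> ('c, 'z) cinfo \<Rightarrow>
   (nat \<Rightarrow> ('x, 'u0, 'u1, 'm, 'p0, 'p1, 'c, 'z) stage) pmf" where
  "continuation_law D g t c =
     do {
       (x, p0, p1) \<leftarrow> belief D t c;
       ns \<leftarrow> Pi_pmf {t..horizon D} undefined (noise_law D);
       run D g ns (Suc (horizon D) - t) t x p0 p1 c
     }"

definition reward_to_go ::
  "('x, 'u0, 'u1, 'n, 'm, 'p0, 'p1, 'c, 'z) problem \<Rightarrow>
   ('u0, 'u1, 'm, 'p0, 'p1, 'c, 'z) profile \<Rightarrow> nat \<Rightarrow> ('c, 'z) cinfo \<Rightarrow> real" where
  "reward_to_go D g t c =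
     measure_pmf.expectation (continuation_law D g t c)
       (\<lambda>w. \<Sum>k=t..horizon D. reward D k (X (w k)) (U0 (w k)) (U1 (w k)))"

definition CISR ::
  "('x, 'u0, 'u1, 'n, 'm, 'p0, 'p1, 'c, 'z) problem \<Rightarrow> ('m, 'p0, 'c, 'z) mstrategy \<Rightarrow>
   ('u0, 'p0, 'c, 'z) dstrategy \<Rightarrow> ('u1, 'm, 'p1, 'c, 'z) astrategy \<Rightarrow> bool" where
  "CISR D gm h0 h1 \<longleftrightarrow>
     (\<forall>t\<in>{1..horizon D}. \<forall>c\<in>possible_commons D t. \<forall>g1\<in>astrategies D.
        reward_to_go D (gm, h0, h1) t c \<ge> reward_to_go D (gm, h0, g1) t c)"

definition eta ::
  "('x, 'u0, 'u1, 'n, 'm, 'p0, 'p1, 'c, 'z) problem \<Rightarrow> ('m, 'p0, 'c, 'z) mstrategy \<Rightarrow> nat \<Rightarrow>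
   'x \<Rightarrow> 'p0 \<Rightarrow> 'p1 \<Rightarrow> 'm \<Rightarrow> 'n \<Rightarrow> ('c, 'z) cinfo \<Rightarrow> real" where
  "eta D gm t x p0 p1 m n c =
     pmf (noise_law D t) n * pmf (belief D t c) (x, p0, p1) * pmf (gm t p0 c) m"

(* Where c is not possible at t this is an arbitrary real number, which only enters sums with
   weight eta = 0. *)
function W ::
  "('x, 'u0, 'u1, 'n, 'm, 'p0, 'p1, 'c, 'z) problem \<Rightarrow> ('m, 'p0, 'c, 'z) mstrategy \<Rightarrow>
   ('u0, 'p0, 'c, 'z) dstrategy \<Rightarrow> ('u1, 'm, 'p1, 'c, 'z) astrategy \<Rightarrow> nat \<Rightarrow>
   ('c, 'z) cinfo \<Rightarrow> real" where
  "W D gm h0 h1 t c =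
     (if t > horizon D then 0
      else \<Sum>x\<in>states D t. \<Sum>p0\<in>dprivs D t. \<Sum>p1\<in>aprivs D t. \<Sum>m\<in>msgs D t. \<Sum>n\<in>noises D t.
        eta D gm t x p0 p1 m n c *
        (reward D t x (h0 t p0 c) (h1 t m p1 c) +
         W D gm h0 h1 (Suc t)
           (Ext c (incr_upd D (Suc t) x p0 p1 (h0 t p0 c) (h1 t m p1 c) n))))"
  by pat_completeness auto
termination
  by (relation "Wellfounded.measure (\<lambda>(D, gm, h0, h1, t, c). Suc (horizon D) - t)") auto

declare W.simps [simp del]

end

(* The tuple (X, P0, P1, C) is a controlled Markov chain; the first step is Markov because of the
   consistency condition on the initial noise.  If c is possible at time t, switching to a profile g
   at time t keeps c possible and leaves its belief unchanged, so strategy independence identifies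
   the conditional law of the next tuple under g, given the next common information, with the
   belief at time t + 1.  Hence the reward-to-go of every agent strategy obeys the one-stage
   recursion defining W, with stage weights eta.  The inequalities then yield CISR by backward
   induction, and CISR yields them by deviating from h1 at a single (t, m, p1, c). *)

theory Submission
  imports Defs
begin

text \<open>Three obstacles shape the proof. A value c in \<open>possible_commons D t\<close> may
  have probability 0 under the profile whose reward-to-go is studied, so nothing can be read off the
  law of that profile at c. This is why a second profile, one that reaches c, is followed before t.
  Conditioning then stays exact because common information records its whole history: the event that
  the next common information extends c is the event that the current one equals c. Second, the
  continuation from time 1 redraws the noise although it may already have shaped the initial
  information; only the conditional law of the first transition enters, and that is what the
  consistency condition fixes. Third, \<open>W\<close> is arbitrary at impossible values, so
  comparisons with it are made only on the support of the stage weights. A deviation at a single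
  point is informative because the stage objective is a sum over (m, p1) of terms that involve the
  agent strategy only through its action at (m, p1). The weights \<open>eta\<close> are not
  normalised, so a pair (m, p1) of probability 0 gives 0 on both sides of the inequality.\<close>

section \<open>Expectations and conditioning for finitely supported and general
  \<open>pmf\<close>\<close>

lemma expectation_bind_pmf_finite:
  fixes h :: "'b \<Rightarrow> real"
  assumes "finite (set_pmf p)" and "\<And>x. x \<in> set_pmf p \<Longrightarrow> finite (set_pmf (f x))"
  shows "measure_pmf.expectation (p \<bind> f) h =
    measure_pmf.expectation p (\<lambda>x. measure_pmf.expectation (f x) h)"
proof -
  have "measure_pmf.expectation (p \<bind> f) h =
      (\<Sum>a\<in>set_pmf p. pmf p a *\<^sub>R measure_pmf.expectation (f a) h)"
    using assms by (intro pmf_expectation_bind) auto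
  then show ?thesis
    using assms(1) by (subst integral_measure_pmf[where A = "set_pmf p"]) auto
qed

lemma expectation_cong_pmf:
  fixes f :: "'a \<Rightarrow> real"
  assumes "\<And>x. x \<in> set_pmf p \<Longrightarrow> f x = g x"
  shows "measure_pmf.expectation p f = measure_pmf.expectation p g"
  using assms by (intro integral_cong_AE) (auto simp: AE_measure_pmf_iff)

lemma expectation_mono_pmf:
  fixes f :: "'a \<Rightarrow> real"
  assumes "finite (set_pmf p)" and "\<And>x. x \<in> set_pmf p \<Longrightarrow> f x \<le> g x"
  shows "measure_pmf.expectation p f \<le> measure_pmf.expectation p g"
  using assms by (intro integral_mono_AE) (auto simp: AE_measure_pmf_iff integrable_measure_pmf_finite)

text \<open>Drawing the value of \<open>f\<close> first and then a point of its fibre reproduces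
  \<open>p\<close>. It is applied twice: to the initial noise given the initial information, and to
  the next information state given the next common information.\<close>

lemma pmf_disintegration:
  "p = map_pmf f p \<bind> (\<lambda>y. cond_pmf p {x. f x = y})"
proof -
  have "p \<bind> (\<lambda>x. cond_pmf p {x'. f x' = f x}) = p"
  proof (rule bind_cond_pmf_cancel)
    fix x y assume "f y = f x"
    then show "measure_pmf.prob p {x'. f x' = f x} = measure_pmf.prob p {x'. f y = f x'}"
      by (simp add: eq_commute)
  qed auto
  then show ?thesis
    by (simp add: bind_map_pmf)
qed

text \<open>Each \<open>f x\<close> gives \<open>B\<close> mass 1 or 0 according to whether
  \<open>x\<close> lies in \<open>A\<close>. Hence both conditionings have the same normalising
  constant (\<open>em\<close>), and the indicators of \<open>A\<close> and \<open>B\<close> agree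
  wherever \<open>f x\<close> charges \<open>y\<close> (\<open>ind\<close>).\<close>

lemma cond_pmf_bind:
  assumes nonempty: "set_pmf p \<inter> A \<noteq> {}"
    and iff: "\<And>x y. x \<in> set_pmf p \<Longrightarrow> y \<in> set_pmf (f x) \<Longrightarrow> y \<in> B \<longleftrightarrow> x \<in> A"
  shows "cond_pmf (p \<bind> f) B = cond_pmf p A \<bind> f"
proof (rule pmf_eqI)
  fix y
  have nonempty': "set_pmf (p \<bind> f) \<inter> B \<noteq> {}"
  proof -
    obtain x where x: "x \<in> set_pmf p" "x \<in> A" using nonempty by auto
    obtain y where "y \<in> set_pmf (f x)" using set_pmf_not_empty[of "f x"] by blast
    then show ?thesis using x iff by auto
  qed
  have "emeasure (f x) B = indicator A x" if "x \<in> set_pmf p" for x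
  proof (cases "x \<in> A")
    case True
    then have "set_pmf (f x) \<subseteq> B" using iff that by auto
    then have "AE y in measure_pmf (f x). y \<in> B" by (auto simp: AE_measure_pmf_iff)
    then show ?thesis using True
      by (simp add: measure_pmf.emeasure_eq_1_AE)
  next
    case False
    then have "AE y in measure_pmf (f x). y \<notin> B" using iff that by (auto simp: AE_measure_pmf_iff)
    then have "emeasure (f x) B = 0" by (simp add: AE_iff_measurable[OF _ refl])
    then show ?thesis using False by simp
  qed
  then have "emeasure (measure_pmf (p \<bind> f)) B = (\<integral>\<^sup>+x. indicator A x \<partial>p)"
    unfolding emeasure_bind_pmf by (intro nn_integral_cong_AE) (simp add: AE_measure_pmf_iff)
  then have em: "emeasure (measure_pmf (p \<bind> f)) B = emeasure p A" by simp
  have ind: "(\<integral>\<^sup>+x. ennreal (pmf (f x) y) * indicator A x \<partial>p) =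
      ennreal (pmf (p \<bind> f) y) * indicator B y"
  proof -
    have "ennreal (pmf (f x) y) * indicator A x = ennreal (pmf (f x) y) * indicator B y"
      if "x \<in> set_pmf p" for x
      using iff[OF that, of y] by (cases "pmf (f x) y = 0") (auto simp: set_pmf_iff indicator_def)
    then have "(\<integral>\<^sup>+x. ennreal (pmf (f x) y) * indicator A x \<partial>p) =
        (\<integral>\<^sup>+x. ennreal (pmf (f x) y) * indicator B y \<partial>p)"
      by (intro nn_integral_cong_AE) (simp add: AE_measure_pmf_iff)
    then show ?thesis by (simp add: ennreal_pmf_bind nn_integral_multc)
  qed
  have "ennreal (pmf (cond_pmf p A \<bind> f) y) =
      (\<integral>\<^sup>+x. ennreal (pmf (f x) y) * indicator A x \<partial>p) / emeasure p A"
    unfolding ennreal_pmf_bind cond_pmf.rep_eq[OF nonempty] by (simp add: nn_integral_uniform_measure)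
  also have "\<dots> = ennreal (pmf (p \<bind> f) y) * indicator B y / emeasure (measure_pmf (p \<bind> f)) B"
    by (simp only: ind em)
  also have "\<dots> = ennreal (pmf (cond_pmf (p \<bind> f) B) y)"
  proof -
    have "measure_pmf.prob (p \<bind> f) B > 0"
      using nonempty' by (meson disjoint_iff measure_pmf_posI)
    then show ?thesis
      by (simp add: pmf_cond[OF nonempty'] measure_pmf.emeasure_eq_measure divide_ennreal
          indicator_def del: emeasure_bind_pmf)
  qed
  finally show "pmf (cond_pmf (p \<bind> f) B) y = pmf (cond_pmf p A \<bind> f) y" by simp
qed

lemma cond_cond_pmf:
  assumes "B \<subseteq> A" and "set_pmf p \<inter> B \<noteq> {}"
  shows "cond_pmf (cond_pmf p A) B = cond_pmf p B"
proof (rule pmf_eqI)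
  fix x
  have A: "set_pmf p \<inter> A \<noteq> {}" using assms by auto
  have B: "set_pmf (cond_pmf p A) \<inter> B \<noteq> {}" using assms by (auto simp: set_cond_pmf[OF A])
  have pos: "measure_pmf.prob p A > 0"
    using A by (meson disjoint_iff measure_pmf_posI)
  have "measure_pmf.prob (cond_pmf p A) B = measure_pmf.prob p B / measure_pmf.prob p A"
    using assms(1) pos unfolding cond_pmf.rep_eq[OF A]
    by (simp add: measure_pmf.emeasure_eq_measure Int_absorb1)
  then show "pmf (cond_pmf (cond_pmf p A) B) x = pmf (cond_pmf p B) x"
    using assms pos by (auto simp: pmf_cond[OF A] pmf_cond[OF B] pmf_cond[OF assms(2)])
qed

section \<open>Information states and the run with noise drawn stage by stage\<close>

type_synonym ('x, 'p0, 'p1, 'c, 'z) info_state = "'x \<times> 'p0 \<times> 'p1 \<times> ('c, 'z) cinfo"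

fun message_law ::
  "('u0, 'u1, 'm, 'p0, 'p1, 'c, 'z) profile \<Rightarrow> nat \<Rightarrow> ('x, 'p0, 'p1, 'c, 'z) info_state \<Rightarrow> 'm pmf"
where
  "message_law (gm, g0, g1) t (x, p0, p1, c) = gm t p0 c"

fun transition ::
  "('x, 'u0, 'u1, 'n, 'm, 'p0, 'p1, 'c, 'z) problem \<Rightarrow>
   ('u0, 'u1, 'm, 'p0, 'p1, 'c, 'z) profile \<Rightarrow> nat \<Rightarrow> ('x, 'p0, 'p1, 'c, 'z) info_state \<Rightarrow>
   'm \<Rightarrow> 'n \<Rightarrow> ('x, 'p0, 'p1, 'c, 'z) info_state"
where
  "transition D (gm, g0, g1) t (x, p0, p1, c) m n =
     (dyn D t x (g0 t p0 c) (g1 t m p1 c) n,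
      dpriv_upd D (Suc t) x p0 (g0 t p0 c) (g1 t m p1 c) n,
      apriv_upd D (Suc t) x p1 (g0 t p0 c) (g1 t m p1 c) n,
      Ext c (incr_upd D (Suc t) x p0 p1 (g0 t p0 c) (g1 t m p1 c) n))"

fun stage_of ::
  "('u0, 'u1, 'm, 'p0, 'p1, 'c, 'z) profile \<Rightarrow> nat \<Rightarrow> ('x, 'p0, 'p1, 'c, 'z) info_state \<Rightarrow>
   'm \<Rightarrow> ('x, 'u0, 'u1, 'm, 'p0, 'p1, 'c, 'z) stage"
where
  "stage_of (gm, g0, g1) t (x, p0, p1, c) m =
     \<lparr>X = x, P0 = p0, P1 = p1, C = c, M1 = m, U0 = g0 t p0 c, U1 = g1 t m p1 c\<rparr>"

definition info_at ::
  "(nat \<Rightarrow> ('x, 'u0, 'u1, 'm, 'p0, 'p1, 'c, 'z) stage) \<Rightarrow> nat \<Rightarrow>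
   ('x, 'p0, 'p1, 'c, 'z) info_state"
where
  "info_at w t = (X (w t), P0 (w t), P1 (w t), C (w t))"

lemma info_at_upd [simp]:
  "info_at (w(t := stage_of g t s m)) j = (if j = t then s else info_at w j)"
  by (cases g; cases s) (simp add: info_at_def)

text \<open>The noise is fresh here for every t, including t = 1, where under \<open>law\<close> it
  may be correlated with the information state. Identifying this kernel with the actual first
  transition is therefore a separate step.\<close>

definition info_kernel ::
  "('x, 'u0, 'u1, 'n, 'm, 'p0, 'p1, 'c, 'z) problem \<Rightarrow>
   ('u0, 'u1, 'm, 'p0, 'p1, 'c, 'z) profile \<Rightarrow> nat \<Rightarrow> ('x, 'p0, 'p1, 'c, 'z) info_state \<Rightarrow>
   ('x, 'p0, 'p1, 'c, 'z) info_state pmf"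
where
  "info_kernel D g t s = message_law g t s \<bind> (\<lambda>m. map_pmf (transition D g t s m) (noise_law D t))"

text \<open>The process whose noise is drawn stage by stage instead of in advance.\<close>

primrec noisy_run ::
  "('x, 'u0, 'u1, 'n, 'm, 'p0, 'p1, 'c, 'z) problem \<Rightarrow>
   ('u0, 'u1, 'm, 'p0, 'p1, 'c, 'z) profile \<Rightarrow> nat \<Rightarrow> nat \<Rightarrow>
   ('x, 'p0, 'p1, 'c, 'z) info_state \<Rightarrow>
   (nat \<Rightarrow> ('x, 'u0, 'u1, 'm, 'p0, 'p1, 'c, 'z) stage) pmf"
where
  "noisy_run D g 0 t s = return_pmf (\<lambda>_. undefined)"
| "noisy_run D g (Suc k) t s =
     message_law g t s \<bind> (\<lambda>m. noise_law D t \<bind> (\<lambda>n.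
       map_pmf (\<lambda>w. w(t := stage_of g t s m)) (noisy_run D g k (Suc t) (transition D g t s m n))))"

definition run_from ::
  "('x, 'u0, 'u1, 'n, 'm, 'p0, 'p1, 'c, 'z) problem \<Rightarrow>
   ('u0, 'u1, 'm, 'p0, 'p1, 'c, 'z) profile \<Rightarrow> (nat \<Rightarrow> 'n) \<Rightarrow> nat \<Rightarrow> nat \<Rightarrow>
   ('x, 'p0, 'p1, 'c, 'z) info_state \<Rightarrow>
   (nat \<Rightarrow> ('x, 'u0, 'u1, 'm, 'p0, 'p1, 'c, 'z) stage) pmf"
where
  "run_from D g ns k t s = (case s of (x, p0, p1, c) \<Rightarrow> run D g ns k t x p0 p1 c)"

lemma run_from_0: "run_from D g ns 0 t s = return_pmf (\<lambda>_. undefined)"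
  by (cases s) (simp add: run_from_def)

lemma run_from_Suc:
  "run_from D g ns (Suc k) t s = message_law g t s \<bind> (\<lambda>m.
     map_pmf (\<lambda>w. w(t := stage_of g t s m))
       (run_from D g ns k (Suc t) (transition D g t s m (ns t))))"
  by (cases g; cases s) (simp add: run_from_def map_pmf_def Let_def)

lemma run_from_cong_noise:
  assumes "\<And>j. t \<le> j \<Longrightarrow> ns j = ns' j"
  shows "run_from D g ns k t s = run_from D g ns' k t s"
  using assms by (induction k arbitrary: t s) (simp_all add: run_from_0 run_from_Suc)

lemma run_from_upd_past:
  assumes "j < t"
  shows "run_from D g (ns(j := n)) k t s = run_from D g ns k t s"
  using assms by (intro run_from_cong_noise) auto

lemma Pi_pmf_atLeastLessThan_Suc:
  assumes "a < b"
  shows "Pi_pmf {a..<b} d p =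
    p a \<bind> (\<lambda>y. map_pmf (\<lambda>f. f(a := y)) (Pi_pmf {Suc a..<b} d p))"
proof -
  have "{a..<b} = insert a {Suc a..<b}" using assms by auto
  then show ?thesis
    by (simp add: Pi_pmf_insert pair_pmf_def map_bind_pmf map_pmf_def bind_assoc_pmf bind_return_pmf)
qed

text \<open>Stage t reads only \<open>ns t\<close>, and the remaining coordinates of the product law
  are independent of it, so each noise can be drawn when it is first used.\<close>

lemma Pi_pmf_bind_run_from:
  "Pi_pmf {t..<t + k} undefined (noise_law D) \<bind> (\<lambda>ns. run_from D g ns k t s) = noisy_run D g k t s"
proof (induction k arbitrary: t s)
  case 0
  then show ?case by (simp add: run_from_0)
next
  case (Suc k)
  let ?P = "Pi_pmf {Suc t..<Suc t + k} undefined (noise_law D)"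
  have "Pi_pmf {t..<t + Suc k} undefined (noise_law D) \<bind> (\<lambda>ns. run_from D g ns (Suc k) t s) =
      noise_law D t \<bind> (\<lambda>n. ?P \<bind> (\<lambda>ns. message_law g t s \<bind> (\<lambda>m.
        map_pmf (\<lambda>w. w(t := stage_of g t s m))
          (run_from D g ns k (Suc t) (transition D g t s m n)))))"
    by (subst Pi_pmf_atLeastLessThan_Suc)
      (simp_all add: bind_assoc_pmf bind_map_pmf run_from_Suc run_from_upd_past)
  \<comment> \<open>The law of the message depends on \<open>s\<close> alone, so its draw can be
    moved in front of all noise draws.\<close>
  also have "\<dots> = message_law g t s \<bind> (\<lambda>m. noise_law D t \<bind> (\<lambda>n.
        map_pmf (\<lambda>w. w(t := stage_of g t s m))
          (?P \<bind> (\<lambda>ns. run_from D g ns k (Suc t) (transition D g t s m n)))))"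
    by (subst (2) bind_commute_pmf, subst bind_commute_pmf) (simp add: map_bind_pmf)
  also have "\<dots> = noisy_run D g (Suc k) t s"
    unfolding Suc.IH by simp
  finally show ?case .
qed

lemma map_info_at_noisy_run_start:
  "map_pmf (\<lambda>w. info_at w t) (noisy_run D g (Suc k) t s) = return_pmf s"
  by (simp add: map_bind_pmf pmf.map_comp o_def)

lemma map_info_at_noisy_run_later:
  assumes "j \<noteq> t"
  shows "map_pmf (\<lambda>w. info_at w j) (noisy_run D g (Suc k) t s) =
    info_kernel D g t s \<bind> (\<lambda>s'. map_pmf (\<lambda>w. info_at w j) (noisy_run D g k (Suc t) s'))"
  using assms
  by (simp add: info_kernel_def map_bind_pmf pmf.map_comp o_def bind_assoc_pmf bind_map_pmf)

text \<open>This is the Markov property inside a run. The bound \<open>Suc j < t + k\<close>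
  guarantees that stage \<open>Suc j\<close> is simulated; outside the simulated stages a trajectory
  is undefined.\<close>

lemma map_info_at_noisy_run_Suc:
  assumes "t \<le> j" and "Suc j < t + k"
  shows "map_pmf (\<lambda>w. info_at w (Suc j)) (noisy_run D g k t s) =
    map_pmf (\<lambda>w. info_at w j) (noisy_run D g k t s) \<bind> info_kernel D g j"
  using assms
proof (induction k arbitrary: t s)
  case 0
  then show ?case by simp
next
  case (Suc k)
  show ?case
  proof (cases "t = j")
    case True
    then obtain k' where k: "k = Suc k'" using Suc.prems by (cases k) auto
    show ?thesis
      unfolding True map_info_at_noisy_run_start
      by (subst map_info_at_noisy_run_later)
        (simp_all add: k map_info_at_noisy_run_start bind_return_pmf bind_return_pmf' del: noisy_run.simps)
  next
    case False
    with Suc.prems have "Suc t \<le> j" "Suc j < Suc t + k" "Suc j \<noteq> t" "j \<noteq> t" by auto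
    then show ?thesis
      by (simp add: map_info_at_noisy_run_later Suc.IH bind_assoc_pmf del: noisy_run.simps)
  qed
qed

lemma noisy_run_cong_agent:
  assumes "\<And>j. t \<le> j \<Longrightarrow> g1 j = g1' j"
  shows "noisy_run D (gm, g0, g1) k t s = noisy_run D (gm, g0, g1') k t s"
  using assms
proof (induction k arbitrary: t s)
  case (Suc k)
  have "noisy_run D (gm, g0, g1) k (Suc t) s' = noisy_run D (gm, g0, g1') k (Suc t) s'" for s'
    using Suc.prems by (intro Suc.IH) auto
  then show ?case
    using Suc.prems[of t] by (cases s) simp
qed simp

section \<open>The law of the information state, with the initial noise kept apart\<close>

definition info_dist ::
  "('x, 'u0, 'u1, 'n, 'm, 'p0, 'p1, 'c, 'z) problem \<Rightarrow>
   ('u0, 'u1, 'm, 'p0, 'p1, 'c, 'z) profile \<Rightarrow> nat \<Rightarrow> ('x, 'p0, 'p1, 'c, 'z) info_state pmf"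
where
  "info_dist D g t = map_pmf (\<lambda>w. info_at w t) (law D g)"

abbreviation common :: "('x, 'p0, 'p1, 'c, 'z) info_state \<Rightarrow> ('c, 'z) cinfo" where
  "common s \<equiv> snd (snd (snd s))"

definition info_states ::
  "('x, 'u0, 'u1, 'n, 'm, 'p0, 'p1, 'c, 'z) problem \<Rightarrow> nat \<Rightarrow> ('x, 'p0, 'p1, 'c, 'z) info_state set"
where
  "info_states D t = states D t \<times> dprivs D t \<times> aprivs D t \<times> commons D t"

text \<open>The noise of time 1 is retained beside the information because it drives the first
  transition as well. This is the local \<open>init\<close> of
  \<open>initial_noise_consistent\<close>, so that condition can be folded to it.\<close>

definition initial_pair ::
  "('x, 'u0, 'u1, 'n, 'm, 'p0, 'p1, 'c, 'z) problem \<Rightarrow> (('x \<times> 'p0 \<times> 'p1 \<times> 'c) \<times> 'n) pmf"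
where
  "initial_pair D = do {
     x \<leftarrow> state_law D;
     n \<leftarrow> noise_law D 1;
     (p0, p1, c) \<leftarrow> info_law D x n;
     return_pmf ((x, p0, p1, c), n)
   }"

definition embed_initial :: "'x \<times> 'p0 \<times> 'p1 \<times> 'c \<Rightarrow> ('x, 'p0, 'p1, 'c, 'z) info_state" where
  "embed_initial = (\<lambda>(x, p0, p1, c). (x, p0, p1, Init c))"

text \<open>Only the noise of time 1 is used twice, so it alone is split off from the product law;
  the later noises can be drawn stage by stage.\<close>

lemma law_eq_bind_initial_pair:
  fixes D :: "('x, 'u0, 'u1, 'n, 'm, 'p0, 'p1, 'c, 'z) problem"
  assumes "horizon D = Suc k"
  shows "law D g = initial_pair D \<bind> (\<lambda>(y, n). message_law g 1 (embed_initial y) \<bind> (\<lambda>m.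
    map_pmf (\<lambda>w. w(1 := stage_of g 1 (embed_initial y) m))
      (noisy_run D g k 2 (transition D g 1 (embed_initial y) m n))))"
    (is "_ = initial_pair D \<bind> (\<lambda>(y, n). ?F y n)")
proof -
  let ?P = "Pi_pmf {2..<2 + k} undefined (noise_law D)"
  have P: "Pi_pmf {1..horizon D} undefined (noise_law D) =
      noise_law D 1 \<bind> (\<lambda>n. map_pmf (\<lambda>f. f(1 := n)) ?P)"
    using Pi_pmf_atLeastLessThan_Suc[of 1 "2 + k" undefined "noise_law D"]
    by (simp add: assms atLeastLessThanSuc_atLeastAtMost numeral_2_eq_2)
  have F: "?P \<bind> (\<lambda>ns. run_from D g (ns(1 := n)) (Suc k) 1 (embed_initial y)) = ?F y n" for y n
  proof -
    have "?P \<bind> (\<lambda>ns. run_from D g (ns(1 := n)) (Suc k) 1 (embed_initial y)) =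
        ?P \<bind> (\<lambda>ns. message_law g 1 (embed_initial y) \<bind> (\<lambda>m.
          map_pmf (\<lambda>w. w(1 := stage_of g 1 (embed_initial y) m))
            (run_from D g ns k 2 (transition D g 1 (embed_initial y) m n))))"
      by (simp add: run_from_Suc run_from_upd_past numeral_2_eq_2)
    also have "\<dots> = ?F y n"
      by (subst bind_commute_pmf) (simp only: map_bind_pmf[symmetric] Pi_pmf_bind_run_from)
    finally show ?thesis .
  qed
  have "law D g = state_law D \<bind> (\<lambda>x. noise_law D 1 \<bind> (\<lambda>n. ?P \<bind> (\<lambda>ns.
      info_law D x n \<bind> (\<lambda>(p0, p1, c).
        run_from D g (ns(1 := n)) (Suc k) 1 (embed_initial (x, p0, p1, c))))))"
    by (simp add: law_def P[unfolded assms] bind_assoc_pmf bind_map_pmf run_from_def embed_initial_def assms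
        del: run.simps One_nat_def)
  \<comment> \<open>\<open>law\<close> draws all noises before the initial information; the later
    ones do not affect that information and are moved behind it.\<close>
  also have "\<dots> = state_law D \<bind> (\<lambda>x. noise_law D 1 \<bind> (\<lambda>n.
      info_law D x n \<bind> (\<lambda>(p0, p1, c). ?F (x, p0, p1, c) n)))"
    by (subst bind_commute_pmf) (simp only: case_prod_unfold F)
  also have "\<dots> = initial_pair D \<bind> (\<lambda>(y, n). ?F y n)"
    by (simp add: initial_pair_def bind_assoc_pmf bind_return_pmf case_prod_unfold)
  finally show ?thesis .
qed

lemma info_dist_1:
  assumes "1 \<le> horizon D"
  shows "info_dist D g 1 = map_pmf (embed_initial \<circ> fst) (initial_pair D)"
proof -
  obtain k where k: "horizon D = Suc k" using assms by (cases "horizon D") auto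
  have "info_dist D g 1 = initial_pair D \<bind> (\<lambda>(y, n). return_pmf (embed_initial y))"
    by (simp add: info_dist_def law_eq_bind_initial_pair[OF k] map_bind_pmf case_prod_unfold
        pmf.map_comp o_def)
  then show ?thesis
    by (simp add: map_pmf_def case_prod_unfold)
qed

lemma info_dist_later:
  assumes "horizon D = Suc k" and "2 \<le> t"
  shows "info_dist D g t = initial_pair D \<bind> (\<lambda>(y, n). message_law g 1 (embed_initial y) \<bind> (\<lambda>m.
    map_pmf (\<lambda>w. info_at w t) (noisy_run D g k 2 (transition D g 1 (embed_initial y) m n))))"
  using assms(2)
  by (simp add: info_dist_def law_eq_bind_initial_pair[OF assms(1)] map_bind_pmf case_prod_unfold
      pmf.map_comp o_def)

section \<open>Supports and the Markov property under \<open>law\<close>\<close>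

locale belief_problem =
  fixes D :: "('x, 'u0, 'u1, 'n, 'm, 'p0, 'p1, 'c, 'z) problem"
  assumes wf: "wf_problem D"
    and beliefs: "strategy_independent_beliefs D"
    and noise_consistent: "initial_noise_consistent D"
begin

lemma horizon_ge_1: "1 \<le> horizon D"
  using wf by (simp add: wf_problem_def)

lemma noise_in: "t \<in> {1..horizon D} \<Longrightarrow> set_pmf (noise_law D t) \<subseteq> noises D t"
  using wf unfolding wf_problem_def by blast

lemma finite_sets:
  assumes "t \<in> {1..horizon D}"
  shows "finite (states D t)" "finite (noises D t)" "finite (msgs D t)"
    "finite (dprivs D t)" "finite (aprivs D t)"
  using wf assms unfolding wf_problem_def by blast+

lemma message_in:
  assumes "(gm, g0, g1) \<in> profiles D" and "t \<in> {1..horizon D}" and "(x, p0, p1, c) \<in> info_states D t"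
  shows "set_pmf (gm t p0 c) \<subseteq> msgs D t"
  using assms unfolding profiles_def mstrategies_def info_states_def by auto

lemma action_in:
  assumes "(gm, g0, g1) \<in> profiles D" and "t \<in> {1..horizon D}" and "(x, p0, p1, c) \<in> info_states D t"
    and "m \<in> msgs D t"
  shows "g0 t p0 c \<in> dacts D t" and "g1 t m p1 c \<in> aacts D t"
  using assms unfolding profiles_def dstrategies_def astrategies_def info_states_def by auto

lemma message_law_in:
  assumes "g \<in> profiles D" and "t \<in> {1..horizon D}" and "s \<in> info_states D t"
  shows "set_pmf (message_law g t s) \<subseteq> msgs D t"
  using assms by (cases g; cases s) (simp add: message_in del: prod.simps)

lemma transition_in:
  assumes "g \<in> profiles D" and "t \<in> {1..<horizon D}" and "s \<in> info_states D t"
    and "m \<in> msgs D t" and "n \<in> noises D t"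
  shows "transition D g t s m n \<in> info_states D (Suc t)"
proof -
  obtain gm g0 g1 where g: "g = (gm, g0, g1)" by (cases g)
  obtain x p0 p1 c where s: "s = (x, p0, p1, c)" by (cases s)
  have t: "t \<in> {1..horizon D}" using assms(2) by auto
  obtain t' where t': "t = Suc t'" using assms(2) by (cases t) auto
  have "g0 t p0 c \<in> dacts D t" "g1 t m p1 c \<in> aacts D t"
    using action_in[OF _ t, of gm g0 g1 x p0 p1 c m] assms g s by auto
  moreover have "x \<in> states D t" "p0 \<in> dprivs D t" "p1 \<in> aprivs D t" "c \<in> commons D t"
    using assms(3) s by (auto simp: info_states_def)
  ultimately have
    "dyn D t x (g0 t p0 c) (g1 t m p1 c) n \<in> states D (Suc t) \<and>
     dpriv_upd D (Suc t) x p0 (g0 t p0 c) (g1 t m p1 c) n \<in> dprivs D (Suc t) \<and>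
     apriv_upd D (Suc t) x p1 (g0 t p0 c) (g1 t m p1 c) n \<in> aprivs D (Suc t) \<and>
     incr_upd D (Suc t) x p0 p1 (g0 t p0 c) (g1 t m p1 c) n \<in> incrs D (Suc t)"
    using wf assms(2,5) unfolding wf_problem_def by blast
  then show ?thesis
    using \<open>c \<in> commons D t\<close> by (simp add: g s t' info_states_def)
qed

lemma info_kernel_in:
  assumes "g \<in> profiles D" and "t \<in> {1..<horizon D}" and "s \<in> info_states D t"
  shows "set_pmf (info_kernel D g t s) \<subseteq> info_states D (Suc t)"
  using transition_in[OF assms] message_law_in[OF assms(1) _ assms(3)] noise_in[of t] assms(2)
  by (fastforce simp: info_kernel_def)

lemma initial_pair_in:
  assumes "y \<in> fst ` set_pmf (initial_pair D)"
  shows "embed_initial y \<in> info_states D 1"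
proof -
  obtain x n p0 p1 c where y: "y = (x, p0, p1, c)" "x \<in> set_pmf (state_law D)"
      "n \<in> set_pmf (noise_law D 1)" "(p0, p1, c) \<in> set_pmf (info_law D x n)"
    using assms by (auto simp: initial_pair_def)
  then have "x \<in> states D 1" "n \<in> noises D 1"
    using wf noise_in[of 1] horizon_ge_1 by (auto simp: wf_problem_def)
  moreover from this have "(p0, p1, c) \<in> dprivs D 1 \<times> aprivs D 1 \<times> init_commons D"
    using wf y unfolding wf_problem_def by blast
  ultimately show ?thesis
    by (auto simp: y info_states_def embed_initial_def)
qed

text \<open>The consistency condition is stated for fixed actions; here they are the ones that
  \<open>g\<close> prescribes at \<open>y\<close> and \<open>m\<close>.\<close>

lemma map_transition_cond_initial_pair:
  assumes "1 < horizon D" and "g \<in> profiles D" and y: "y \<in> fst ` set_pmf (initial_pair D)"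
    and m: "m \<in> msgs D 1"
  shows "map_pmf (\<lambda>i. transition D g 1 (embed_initial y) m (snd i))
      (cond_pmf (initial_pair D) {i. fst i = y}) =
    map_pmf (transition D g 1 (embed_initial y) m) (noise_law D 1)"
proof -
  obtain gm g0 g1 where g: "g = (gm, g0, g1)" by (cases g)
  obtain x p0 p1 c where yy: "y = (x, p0, p1, c)" by (cases y)
  let ?u0 = "g0 1 p0 (Init c)" and ?u1 = "g1 1 m p1 (Init c)"
  let ?step = "\<lambda>n. (dyn D 1 x ?u0 ?u1 n, dpriv_upd D 2 x p0 ?u0 ?u1 n,
                          apriv_upd D 2 x p1 ?u0 ?u1 n, incr_upd D 2 x p0 p1 ?u0 ?u1 n)"
  let ?attach = "\<lambda>(x, p0, p1, z). (x, p0, p1, Ext (Init c) z)"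
  have "?u0 \<in> dacts D 1" "?u1 \<in> aacts D 1"
    using action_in[of gm g0 g1 1 x p0 p1 "Init c" m] initial_pair_in[OF y] assms(1,2) m g yy
    by (auto simp: embed_initial_def)
  then have "map_pmf (\<lambda>(_, n). ?step n) (cond_pmf (initial_pair D) {i. fst i = (x, p0, p1, c)}) =
      map_pmf ?step (noise_law D 1)"
    using noise_consistent assms(1) y
    unfolding initial_noise_consistent_def initial_pair_def[symmetric] Let_def yy by blast
  \<comment> \<open>\<open>?attach\<close> appends the increment to the initial common information,
    which turns the tuple of the consistency condition into an information state.\<close>
  then have "map_pmf ?attach (map_pmf (\<lambda>(_, n). ?step n)
        (cond_pmf (initial_pair D) {i. fst i = (x, p0, p1, c)})) =
      map_pmf ?attach (map_pmf ?step (noise_law D 1))"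
    by simp
  moreover have "transition D g 1 (embed_initial y) m = (\<lambda>n. ?attach (?step n))"
    by (simp add: fun_eq_iff yy g embed_initial_def numeral_2_eq_2)
  ultimately show ?thesis
    by (simp add: pmf.map_comp o_def case_prod_unfold yy)
qed

text \<open>From time 2 on the noise is fresh and the Markov property of \<open>noisy_run\<close>
  applies. For t = 1 the noise is conditioned on the initial information, and the resulting law of
  the transition is replaced by that under fresh noise.\<close>

lemma info_dist_Suc:
  assumes g: "g \<in> profiles D" and t: "t \<in> {1..<horizon D}"
  shows "info_dist D g (Suc t) = info_dist D g t \<bind> info_kernel D g t"
proof -
  obtain k where k: "horizon D = Suc k" using t by (cases "horizon D") auto
  show ?thesis
  proof (cases "t = 1")
    case False
    then have "2 \<le> t" "2 \<le> Suc t" "Suc t < 2 + k" using t k by auto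
    then show ?thesis
      by (simp add: info_dist_later[OF k] map_info_at_noisy_run_Suc bind_assoc_pmf case_prod_unfold)
  next
    case True
    obtain k' where k': "k = Suc k'" using t k True by (cases k) auto
    let ?I = "initial_pair D"
    let ?cond = "\<lambda>y. cond_pmf ?I {i. fst i = y}"
    let ?F = "\<lambda>i. map_pmf (\<lambda>m. transition D g 1 (embed_initial (fst i)) m (snd i))
      (message_law g 1 (embed_initial (fst i)))"
    have "info_dist D g 2 = ?I \<bind> ?F"
      by (simp add: info_dist_later[OF k] k' map_info_at_noisy_run_start case_prod_unfold
          map_pmf_def[symmetric] del: noisy_run.simps)
    also have "\<dots> = map_pmf fst ?I \<bind> (\<lambda>y. ?cond y \<bind> ?F)"
      by (subst pmf_disintegration[of ?I fst]) (simp add: bind_assoc_pmf)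
    also have "\<dots> = map_pmf fst ?I \<bind> (\<lambda>y. info_kernel D g 1 (embed_initial y))"
    proof (rule bind_pmf_cong[OF refl])
      fix y assume "y \<in> set_pmf (map_pmf fst ?I)"
      then have y: "y \<in> fst ` set_pmf ?I" by simp
      then have "set_pmf ?I \<inter> {i. fst i = y} \<noteq> {}" by auto
      then have "?cond y \<bind> ?F = ?cond y \<bind> (\<lambda>i. message_law g 1 (embed_initial y) \<bind>
          (\<lambda>m. return_pmf (transition D g 1 (embed_initial y) m (snd i))))"
        by (intro bind_pmf_cong) (auto simp: map_pmf_def)
      \<comment> \<open>Given \<open>y\<close>, the message is independent of the noise, so the
        noise may be averaged out for each message separately.\<close>
      also have "\<dots> = message_law g 1 (embed_initial y) \<bind> (\<lambda>m.
          map_pmf (\<lambda>i. transition D g 1 (embed_initial y) m (snd i)) (?cond y))"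
        by (subst bind_commute_pmf) (simp add: map_pmf_def)
      also have "\<dots> = info_kernel D g 1 (embed_initial y)"
        unfolding info_kernel_def
        using message_law_in[OF g _ initial_pair_in[OF y]] t True
        by (intro bind_pmf_cong refl map_transition_cond_initial_pair[OF _ g y]) auto
      finally show "?cond y \<bind> ?F = info_kernel D g 1 (embed_initial y)" .
    qed
    also have "\<dots> = info_dist D g 1 \<bind> info_kernel D g 1"
      by (simp add: info_dist_1[OF horizon_ge_1] bind_map_pmf del: One_nat_def)
    finally show ?thesis by (simp add: True numeral_2_eq_2)
  qed
qed

lemma info_dist_in:
  assumes "g \<in> profiles D" and "t \<in> {1..horizon D}"
  shows "set_pmf (info_dist D g t) \<subseteq> info_states D t"
proof -
  have "1 \<le> t" using assms(2) by simp
  then show ?thesis using assms(2)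
  proof (induction t rule: dec_induct)
    case base
    then show ?case
      using initial_pair_in unfolding info_dist_1[OF horizon_ge_1] by force
  next
    case (step t)
    then show ?case
      using info_kernel_in[OF assms(1), of t] by (fastforce simp: info_dist_Suc[OF assms(1)])
  qed
qed

text \<open>Needed for splicing: strategies used from time t on cannot influence which common
  information is possible at t. At time 1 the law does not involve the profile at all.\<close>

lemma info_dist_cong:
  assumes g: "(gm, g0, g1) \<in> profiles D" and g': "(gm', g0', g1') \<in> profiles D"
    and "t \<in> {1..horizon D}"
    and "\<And>j. j < t \<Longrightarrow> gm j = gm' j \<and> g0 j = g0' j \<and> g1 j = g1' j"
  shows "info_dist D (gm, g0, g1) t = info_dist D (gm', g0', g1') t"
proof -
  have "1 \<le> t" using assms(3) by simp
  then show ?thesis using assms(3,4)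
  proof (induction t rule: dec_induct)
    case base
    show ?case by (simp only: info_dist_1[OF horizon_ge_1])
  next
    case (step t)
    have "info_kernel D (gm, g0, g1) t = info_kernel D (gm', g0', g1') t"
      using step.prems(2)[of t] by (auto simp: fun_eq_iff info_kernel_def intro!: bind_pmf_cong map_pmf_cong)
    then show ?case
      using step by (simp add: info_dist_Suc[OF g] info_dist_Suc[OF g'])
  qed
qed

section \<open>Beliefs and their propagation by one stage\<close>

lemma possible_under_iff:
  "possible_under D g t c \<longleftrightarrow> c \<in> common ` set_pmf (info_dist D g t)"
proof -
  have "possible_under D g t c \<longleftrightarrow> set_pmf (law D g) \<inter> common_event t c \<noteq> {}"
    unfolding possible_under_def
    by (metis disjoint_iff less_irrefl measure_pmf_posI measure_pmf_zero_iff zero_less_measure_iff)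
  then show ?thesis
    by (auto simp: common_event_def info_dist_def info_at_def image_iff)
qed

lemma belief_eq:
  assumes "g \<in> profiles D" and "t \<in> {1..horizon D}" and "possible_under D g t c"
  shows "belief D t c = belief_under D g t c"
proof -
  have "\<mu> = belief_under D g t c"
    if "\<exists>g'\<in>profiles D. possible_under D g' t c \<and> \<mu> = belief_under D g' t c" for \<mu>
    using that beliefs assms unfolding strategy_independent_beliefs_def by blast
  then show ?thesis
    unfolding belief_def using assms by (intro the_equality) blast+
qed

text \<open>Reattaching c makes the belief a law on information states, on which
  \<open>info_kernel\<close> acts.\<close>

definition full_belief :: "nat \<Rightarrow> ('c, 'z) cinfo \<Rightarrow> ('x, 'p0, 'p1, 'c, 'z) info_state pmf" where
  "full_belief t c = map_pmf (\<lambda>(x, p0, p1). (x, p0, p1, c)) (belief D t c)"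

text \<open>Conditioning is moved from trajectories to information states. The profile is free as
  long as it makes c possible, which is the form in which strategy independence is used.\<close>

lemma full_belief_eq:
  assumes "g \<in> profiles D" and "t \<in> {1..horizon D}" and "possible_under D g t c"
  shows "full_belief t c = cond_pmf (info_dist D g t) {s. common s = c}"
proof -
  have ne: "set_pmf (law D g) \<inter> common_event t c \<noteq> {}"
    using assms(3) by (auto simp: possible_under_iff info_dist_def info_at_def common_event_def)
  have vimage: "(\<lambda>w. info_at w t) -` {s. common s = c} = common_event t c"
    by (auto simp: info_at_def common_event_def)
  have "full_belief t c = map_pmf (\<lambda>w. (X (w t), P0 (w t), P1 (w t), c)) (cond_pmf (law D g) (common_event t c))"
    by (simp add: full_belief_def belief_eq[OF assms] belief_under_def pmf.map_comp o_def)
  also have "\<dots> = map_pmf (\<lambda>w. info_at w t) (cond_pmf (law D g) (common_event t c))"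
    using ne by (intro map_pmf_cong) (auto simp: info_at_def common_event_def)
  also have "\<dots> = cond_pmf (info_dist D g t) {s. common s = c}"
    unfolding info_dist_def using ne vimage by (subst cond_map_pmf) auto
  finally show ?thesis .
qed

text \<open>The second conclusion says that, once the next common information is revealed, the next
  information state is distributed as the belief there. It holds even if \<open>g\<close> itself
  never reaches c, because \<open>\<nu>\<close> is realised as a conditional law under a profile
  that does.\<close>

lemma full_belief_bind_info_kernel:
  assumes g: "g \<in> profiles D" and t: "t \<in> {1..<horizon D}" and c: "c \<in> possible_commons D t"
  defines "\<nu> \<equiv> full_belief t c \<bind> info_kernel D g t"
  shows "common ` set_pmf \<nu> \<subseteq> possible_commons D (Suc t)"
    and "\<nu> = map_pmf common \<nu> \<bind> full_belief (Suc t)"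
proof -
  obtain gm g0 g1 where gg: "g = (gm, g0, g1)" by (cases g)
  obtain gm' g0' g1' where g': "(gm', g0', g1') \<in> profiles D" "possible_under D (gm', g0', g1') t c"
    using c by (auto simp: possible_commons_def)
  \<comment> \<open>\<open>sw\<close> follows a profile reaching c before time t and
    \<open>g\<close> from t on: the former makes c possible, the latter leaves the kernel at t equal
    to that of \<open>g\<close>.\<close>
  define sw where "sw = (\<lambda>j. if j < t then gm' j else gm j, \<lambda>j. if j < t then g0' j else g0 j,
    \<lambda>j. if j < t then g1' j else g1 j)"
  have sw: "sw \<in> profiles D"
    using g g'(1) unfolding gg sw_def profiles_def mstrategies_def dstrategies_def astrategies_def by auto
  have t': "t \<in> {1..horizon D}" "Suc t \<in> {1..horizon D}" using t by auto
  have "info_dist D sw t = info_dist D (gm', g0', g1') t"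
    using sw g'(1) t'(1) unfolding sw_def by (intro info_dist_cong) auto
  then have poss: "possible_under D sw t c"
    using g'(2) by (simp add: possible_under_iff)
  have kernel: "info_kernel D g t = info_kernel D sw t"
    by (auto simp: fun_eq_iff info_kernel_def gg sw_def intro!: bind_pmf_cong map_pmf_cong)
  let ?M = "info_dist D sw t" and ?M' = "info_dist D sw (Suc t)"
  \<comment> \<open>Every transition appends one increment to the common information, so
    \<open>?B\<close> at time \<open>Suc t\<close> is the event that c occurred at time t.\<close>
  let ?B = "{s. \<exists>z. common s = Ext c z}"
  have M': "?M' = ?M \<bind> info_kernel D sw t"
    by (rule info_dist_Suc[OF sw t])
  have common_kernel: "\<exists>z. common s' = Ext (common s) z" if "s' \<in> set_pmf (info_kernel D sw t s)" for s s'
    using that by (cases s) (auto simp: info_kernel_def sw_def)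
  have \<nu>: "\<nu> = cond_pmf ?M' ?B"
  proof -
    have "cond_pmf ?M' ?B = cond_pmf ?M {s. common s = c} \<bind> info_kernel D sw t"
      unfolding M'
    proof (rule cond_pmf_bind)
      show "set_pmf ?M \<inter> {s. common s = c} \<noteq> {}"
        using poss by (auto simp: possible_under_iff)
      show "s' \<in> ?B \<longleftrightarrow> s \<in> {s. common s = c}" if "s' \<in> set_pmf (info_kernel D sw t s)" for s s'
        using common_kernel[OF that] by auto
    qed
    then show ?thesis
      by (simp add: \<nu>_def full_belief_eq[OF sw t'(1) poss] kernel)
  qed
  have ne: "set_pmf ?M' \<inter> ?B \<noteq> {}"
  proof -
    obtain s where s: "s \<in> set_pmf ?M" "common s = c"
      using poss by (auto simp: possible_under_iff)
    obtain s' where "s' \<in> set_pmf (info_kernel D sw t s)"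
      using set_pmf_not_empty[of "info_kernel D sw t s"] by blast
    then have "s' \<in> set_pmf ?M' \<inter> ?B" using s common_kernel[of s' s] by (auto simp: M' simp del: split_paired_Ex)
    then show ?thesis by blast
  qed
  have supp: "set_pmf \<nu> = set_pmf ?M' \<inter> ?B"
    using ne by (simp add: \<nu>)
  then have poss': "possible_under D sw (Suc t) c'" if "c' \<in> common ` set_pmf \<nu>" for c'
    using that by (auto simp: possible_under_iff)
  then show "common ` set_pmf \<nu> \<subseteq> possible_commons D (Suc t)"
    using sw by (auto simp: possible_commons_def)
  \<comment> \<open>Each fibre lies inside \<open>?B\<close>, so conditioning on \<open>?B\<close>
    beforehand changes nothing, and the result is the belief computed under
    \<open>sw\<close>.\<close>
  have "cond_pmf \<nu> {s. common s = c'} = full_belief (Suc t) c'" if c': "c' \<in> common ` set_pmf \<nu>" for c'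
  proof -
    have "{s. common s = c'} \<subseteq> ?B" "set_pmf ?M' \<inter> {s. common s = c'} \<noteq> {}"
      using c' supp by auto
    then show ?thesis
      unfolding \<nu> full_belief_eq[OF sw t'(2) poss'[OF c']] by (rule cond_cond_pmf)
  qed
  then have "map_pmf common \<nu> \<bind> (\<lambda>c'. cond_pmf \<nu> {s. common s = c'}) =
      map_pmf common \<nu> \<bind> full_belief (Suc t)"
    by (intro bind_pmf_cong) auto
  then show "\<nu> = map_pmf common \<nu> \<bind> full_belief (Suc t)"
    by (rule trans[OF pmf_disintegration])
qed

section \<open>Supports of beliefs and finiteness of runs\<close>

lemma full_belief_in:
  assumes "t \<in> {1..horizon D}" and "c \<in> possible_commons D t"
  shows "set_pmf (full_belief t c) \<subseteq> info_states D t"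
proof -
  obtain g where g: "g \<in> profiles D" "possible_under D g t c"
    using assms(2) by (auto simp: possible_commons_def)
  then have "set_pmf (full_belief t c) = set_pmf (info_dist D g t) \<inter> {s. common s = c}"
    unfolding full_belief_eq[OF g(1) assms(1) g(2)]
    by (intro set_cond_pmf) (auto simp: possible_under_iff)
  then show ?thesis using info_dist_in[OF g(1) assms(1)] by blast
qed

lemma belief_in:
  assumes "t \<in> {1..horizon D}" and "c \<in> possible_commons D t" and "(x, p0, p1) \<in> set_pmf (belief D t c)"
  shows "(x, p0, p1, c) \<in> info_states D t"
proof -
  have "(x, p0, p1, c) \<in> set_pmf (full_belief t c)"
    using assms(3) by (force simp: full_belief_def)
  then show ?thesis using full_belief_in[OF assms(1,2)] by blast
qed

lemma finite_belief:
  assumes "t \<in> {1..horizon D}" and "c \<in> possible_commons D t"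
  shows "finite (set_pmf (belief D t c))"
proof (rule finite_subset)
  show "set_pmf (belief D t c) \<subseteq> states D t \<times> dprivs D t \<times> aprivs D t"
    using belief_in[OF assms] by (auto simp: info_states_def)
qed (use finite_sets[OF assms(1)] in auto)

lemma finite_message_law:
  assumes "g \<in> profiles D" and "t \<in> {1..horizon D}" and "s \<in> info_states D t"
  shows "finite (set_pmf (message_law g t s))"
  using message_law_in[OF assms] finite_sets[OF assms(2)] finite_subset by blast

lemma finite_noise_law: "t \<in> {1..horizon D} \<Longrightarrow> finite (set_pmf (noise_law D t))"
  using noise_in finite_sets finite_subset by blast

text \<open>Membership of \<open>s\<close> is required only for \<open>0 < k\<close>: the transition
  of the last stage, at the horizon, need not land in a declared set.\<close>

lemma finite_noisy_run:
  assumes "g \<in> profiles D" and "1 \<le> t" and "t + k \<le> Suc (horizon D)"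
    and "0 < k \<Longrightarrow> s \<in> info_states D t"
  shows "finite (set_pmf (noisy_run D g k t s))"
  using assms(2-)
proof (induction k arbitrary: t s)
  case 0
  then show ?case by simp
next
  case (Suc k)
  have t: "t \<in> {1..horizon D}" and s: "s \<in> info_states D t" using Suc.prems by auto
  have "finite (set_pmf (noisy_run D g k (Suc t) (transition D g t s m n)))"
    if "m \<in> set_pmf (message_law g t s)" "n \<in> set_pmf (noise_law D t)" for m n
    using Suc.prems that message_law_in[OF assms(1) t s] noise_in[OF t]
    by (intro Suc.IH transition_in[OF assms(1)]) auto
  then show ?case
    using finite_message_law[OF assms(1) t s] finite_noise_law[OF t] by simp
qed

section \<open>Reward-to-go and its one-stage recursion\<close>

definition run_value ::
  "('u0, 'u1, 'm, 'p0, 'p1, 'c, 'z) profile \<Rightarrow> nat \<Rightarrow> nat \<Rightarrow>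
   ('x, 'p0, 'p1, 'c, 'z) info_state \<Rightarrow> real"
where
  "run_value g k t s = measure_pmf.expectation (noisy_run D g k t s)
     (\<lambda>w. \<Sum>j=t..<t + k. reward D j (X (w j)) (U0 (w j)) (U1 (w j)))"

lemma run_value_0 [simp]: "run_value g 0 t s = 0"
  by (simp add: run_value_def)

lemma run_value_Suc:
  assumes g: "(gm, g0, g1) \<in> profiles D" and t: "t \<in> {1..horizon D}" and k: "t + k \<le> horizon D"
    and s: "(x, p0, p1, c) \<in> info_states D t"
  shows "run_value (gm, g0, g1) (Suc k) t (x, p0, p1, c) =
    measure_pmf.expectation (gm t p0 c) (\<lambda>m. measure_pmf.expectation (noise_law D t) (\<lambda>n.
      reward D t x (g0 t p0 c) (g1 t m p1 c) +
      run_value (gm, g0, g1) k (Suc t) (transition D (gm, g0, g1) t (x, p0, p1, c) m n)))"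
proof -
  let ?g = "(gm, g0, g1)" and ?s = "(x, p0, p1, c)"
  let ?next = "\<lambda>m n. noisy_run D ?g k (Suc t) (transition D ?g t ?s m n)"
  let ?S = "\<lambda>w. \<Sum>j=t..<t + Suc k. reward D j (X (w j)) (U0 (w j)) (U1 (w j))"
  let ?S' = "\<lambda>w. \<Sum>j=Suc t..<Suc t + k. reward D j (X (w j)) (U0 (w j)) (U1 (w j))"
  let ?up = "\<lambda>m w. w(t := stage_of ?g t ?s m)"
  let ?E = measure_pmf.expectation
  have fin_m: "finite (set_pmf (gm t p0 c))" using finite_message_law[OF g t s] by simp
  note fin_n = finite_noise_law[OF t]
  have fin_next: "finite (set_pmf (?next m n))"
    if "m \<in> set_pmf (gm t p0 c)" "n \<in> set_pmf (noise_law D t)" for m n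
    using that message_in[OF g t s] noise_in[OF t] k t s g
    by (intro finite_noisy_run transition_in) auto
  have upd: "?S (?up m w) = reward D t x (g0 t p0 c) (g1 t m p1 c) + ?S' w" for w m
  proof -
    have "{t..<t + Suc k} = insert t {Suc t..<Suc t + k}" by auto
    then show ?thesis by simp
  qed
  have "run_value ?g (Suc k) t ?s =
      ?E (gm t p0 c \<bind> (\<lambda>m. noise_law D t \<bind> (\<lambda>n. map_pmf (?up m) (?next m n)))) ?S"
    unfolding run_value_def noisy_run.simps message_law.simps ..
  also have "\<dots> = ?E (gm t p0 c) (\<lambda>m. ?E (noise_law D t \<bind> (\<lambda>n. map_pmf (?up m) (?next m n))) ?S)"
    using fin_m fin_n fin_next by (intro expectation_bind_pmf_finite) auto
  also have "\<dots> = ?E (gm t p0 c) (\<lambda>m. ?E (noise_law D t) (\<lambda>n. ?E (map_pmf (?up m) (?next m n)) ?S))"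
    using fin_n fin_next by (intro expectation_cong_pmf expectation_bind_pmf_finite) auto
  also have "\<dots> = ?E (gm t p0 c) (\<lambda>m. ?E (noise_law D t)
      (\<lambda>n. reward D t x (g0 t p0 c) (g1 t m p1 c) + run_value ?g k (Suc t) (transition D ?g t ?s m n)))"
    unfolding integral_map_pmf upd run_value_def
    using fin_next by (intro expectation_cong_pmf) (simp add: integrable_measure_pmf_finite)
  finally show ?thesis .
qed

lemma continuation_law_eq:
  assumes "t \<le> Suc (horizon D)"
  shows "continuation_law D g t c = full_belief t c \<bind> noisy_run D g (Suc (horizon D) - t) t"
proof -
  have "{t..horizon D} = {t..<t + (Suc (horizon D) - t)}" using assms by auto
  then show ?thesis
    unfolding continuation_law_def full_belief_def
    by (simp add: bind_map_pmf Pi_pmf_bind_run_from[symmetric] run_from_def case_prod_unfold)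
qed

lemma reward_to_go_eq:
  assumes g: "g \<in> profiles D" and t: "t \<in> {1..horizon D}" and c: "c \<in> possible_commons D t"
  shows "reward_to_go D g t c =
    measure_pmf.expectation (full_belief t c) (run_value g (Suc (horizon D) - t) t)"
proof -
  let ?k = "Suc (horizon D) - t"
  have interval: "{t..horizon D} = {t..<t + ?k}" and t': "t \<le> Suc (horizon D)" using t by auto
  have "finite (set_pmf (full_belief t c))"
    using finite_belief[OF t c] by (simp add: full_belief_def)
  moreover have "finite (set_pmf (noisy_run D g ?k t s))" if "s \<in> set_pmf (full_belief t c)" for s
    using that full_belief_in[OF t c] t by (intro finite_noisy_run[OF g]) auto
  ultimately show ?thesis
    unfolding reward_to_go_def run_value_def interval continuation_law_eq[OF t']
    by (rule expectation_bind_pmf_finite)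
qed

lemma reward_to_go_after_horizon: "reward_to_go D g (Suc (horizon D)) c = 0"
  by (simp add: reward_to_go_def)

text \<open>This realises \<open>eta\<close> as a distribution. Weighted sums become expectations,
  and integrands need to be compared only on its support, which implements the convention on terms
  of weight 0.\<close>

definition stage_law ::
  "('m, 'p0, 'c, 'z) mstrategy \<Rightarrow> nat \<Rightarrow> ('c, 'z) cinfo \<Rightarrow> ('x \<times> 'p0 \<times> 'p1 \<times> 'm \<times> 'n) pmf"
where
  "stage_law gm t c = belief D t c \<bind> (\<lambda>(x, p0, p1).
     map_pmf (\<lambda>(m, n). (x, p0, p1, m, n)) (pair_pmf (gm t p0 c) (noise_law D t)))"

lemma pmf_stage_law: "pmf (stage_law gm t c) (x, p0, p1, m, n) = eta D gm t x p0 p1 m n c"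
proof -
  let ?k = "\<lambda>(x, p0, p1). map_pmf (\<lambda>(m, n). (x, p0, p1, m, n)) (pair_pmf (gm t p0 c) (noise_law D t))"
  have inj: "inj (\<lambda>(m, n). (x, p0, p1, m, n))" by (auto simp: inj_def)
  have "pmf (stage_law gm t c) (x, p0, p1, m, n) =
      measure_pmf.expectation (belief D t c) (\<lambda>y. pmf (?k y) (x, p0, p1, m, n))"
    by (simp add: stage_law_def pmf_bind)
  also have "\<dots> = pmf (?k (x, p0, p1)) (x, p0, p1, m, n) * pmf (belief D t c) (x, p0, p1)"
    \<comment> \<open>The sampled tuple carries its own (x, p0, p1), so a single atom of the belief
      contributes.\<close>
    by (subst integral_measure_pmf_real[where A = "{(x, p0, p1)}"]) (auto simp: pmf_eq_0_set_pmf)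
  also have "pmf (?k (x, p0, p1)) (x, p0, p1, m, n) = pmf (gm t p0 c) m * pmf (noise_law D t) n"
    using pmf_map_inj'[OF inj, of "pair_pmf (gm t p0 c) (noise_law D t)" "(m, n)"] by (simp add: pmf_pair)
  finally show ?thesis by (simp add: eta_def)
qed

lemma stage_law_in:
  assumes "gm \<in> mstrategies D" and "t \<in> {1..horizon D}" and "c \<in> possible_commons D t"
  shows "set_pmf (stage_law gm t c) \<subseteq> states D t \<times> dprivs D t \<times> aprivs D t \<times> msgs D t \<times> noises D t"
proof
  fix e assume "e \<in> set_pmf (stage_law gm t c)"
  then obtain x p0 p1 m n where e: "e = (x, p0, p1, m, n)" and b: "(x, p0, p1) \<in> set_pmf (belief D t c)"
    and m: "m \<in> set_pmf (gm t p0 c)" and n: "n \<in> set_pmf (noise_law D t)"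
    by (auto simp: stage_law_def)
  have "x \<in> states D t" "p0 \<in> dprivs D t" "p1 \<in> aprivs D t" "c \<in> commons D t"
    using belief_in[OF assms(2,3) b] by (auto simp: info_states_def)
  moreover from this have "m \<in> msgs D t"
    using m assms(1,2) unfolding mstrategies_def by blast
  moreover have "n \<in> noises D t" using n noise_in[OF assms(2)] by blast
  ultimately show "e \<in> states D t \<times> dprivs D t \<times> aprivs D t \<times> msgs D t \<times> noises D t"
    by (simp add: e)
qed

lemma finite_stage_law:
  assumes "gm \<in> mstrategies D" and "t \<in> {1..horizon D}" and "c \<in> possible_commons D t"
  shows "finite (set_pmf (stage_law gm t c))"
  by (intro finite_subset[OF stage_law_in[OF assms]] finite_cartesian_product finite_sets[OF assms(2)])

lemma expectation_stage_law:
  assumes "gm \<in> mstrategies D" and "t \<in> {1..horizon D}" and "c \<in> possible_commons D t"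
  shows "measure_pmf.expectation (stage_law gm t c) (\<lambda>(x, p0, p1, m, n). f x p0 p1 m n) =
    (\<Sum>x\<in>states D t. \<Sum>p0\<in>dprivs D t. \<Sum>p1\<in>aprivs D t. \<Sum>m\<in>msgs D t. \<Sum>n\<in>noises D t.
      eta D gm t x p0 p1 m n c * f x p0 p1 m n)"
proof -
  have "measure_pmf.expectation (stage_law gm t c) (\<lambda>(x, p0, p1, m, n). f x p0 p1 m n) =
      (\<Sum>e\<in>states D t \<times> dprivs D t \<times> aprivs D t \<times> msgs D t \<times> noises D t.
        (case e of (x, p0, p1, m, n) \<Rightarrow> f x p0 p1 m n) * pmf (stage_law gm t c) e)"
    using stage_law_in[OF assms]
    by (intro integral_measure_pmf_real finite_cartesian_product finite_sets[OF assms(2)]) blast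
  also have "\<dots> = (\<Sum>(x, p0, p1, m, n)\<in>states D t \<times> dprivs D t \<times> aprivs D t \<times> msgs D t \<times> noises D t.
      eta D gm t x p0 p1 m n c * f x p0 p1 m n)"
    by (intro sum.cong) (auto simp: pmf_stage_law)
  finally show ?thesis
    by (simp add: sum.cartesian_product[symmetric])
qed

lemma map_transition_stage_law:
  "map_pmf (\<lambda>(x, p0, p1, m, n). transition D (gm, g0, g1) t (x, p0, p1, c) m n) (stage_law gm t c) =
    full_belief t c \<bind> info_kernel D (gm, g0, g1) t"
proof -
  have "map_pmf (\<lambda>(x, p0, p1, m, n). transition D (gm, g0, g1) t (x, p0, p1, c) m n)
      (map_pmf (\<lambda>(m, n). (x, p0, p1, m, n)) (pair_pmf (gm t p0 c) (noise_law D t))) =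
    info_kernel D (gm, g0, g1) t (x, p0, p1, c)" for x p0 p1
    by (simp add: info_kernel_def pair_pmf_def map_pmf_def bind_assoc_pmf bind_return_pmf case_prod_unfold del: transition.simps)
  then show ?thesis
    by (simp add: stage_law_def full_belief_def map_bind_pmf bind_map_pmf case_prod_unfold
        del: transition.simps)
qed

text \<open>Beliefs, and hence the recursion, are meaningful only at possible values; this keeps an
  induction over time inside them.\<close>

lemma Ext_possible:
  assumes g: "(gm, g0, g1) \<in> profiles D" and t: "t \<in> {1..<horizon D}" and c: "c \<in> possible_commons D t"
    and e: "(x, p0, p1, m, n) \<in> set_pmf (stage_law gm t c)"
  shows "Ext c (incr_upd D (Suc t) x p0 p1 (g0 t p0 c) (g1 t m p1 c) n) \<in> possible_commons D (Suc t)"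
proof -
  have "transition D (gm, g0, g1) t (x, p0, p1, c) m n \<in>
      set_pmf (full_belief t c \<bind> info_kernel D (gm, g0, g1) t)"
    unfolding map_transition_stage_law[symmetric] using e by (force simp del: transition.simps)
  then have "common (transition D (gm, g0, g1) t (x, p0, p1, c) m n) \<in> possible_commons D (Suc t)"
    using full_belief_bind_info_kernel(1)[OF g t c] by blast
  then show ?thesis by simp
qed

text \<open>The run continues from the actual next information state, whereas the reward-to-go
  redraws that state from the belief. Averaged over the next common information the two agree,
  because beliefs propagate consistently.\<close>

lemma reward_to_go_recursion:
  assumes g: "(gm, g0, g1) \<in> profiles D" and t: "t \<in> {1..horizon D}" and c: "c \<in> possible_commons D t"
  shows "reward_to_go D (gm, g0, g1) t c = measure_pmf.expectation (stage_law gm t c)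
    (\<lambda>(x, p0, p1, m, n). reward D t x (g0 t p0 c) (g1 t m p1 c) +
      reward_to_go D (gm, g0, g1) (Suc t)
        (Ext c (incr_upd D (Suc t) x p0 p1 (g0 t p0 c) (g1 t m p1 c) n)))"
proof -
  let ?g = "(gm, g0, g1)" and ?k = "horizon D - t"
  let ?E = "measure_pmf.expectation (stage_law gm t c)"
  let ?next = "\<lambda>(x, p0, p1, m, n). transition D ?g t (x, p0, p1, c) m n"
  let ?r = "\<lambda>(x, p0, p1, m, n). reward D t x (g0 t p0 c) (g1 t m p1 c)"
  let ?J = "reward_to_go D ?g (Suc t)"
  have gm: "gm \<in> mstrategies D" using g by (simp add: profiles_def)
  note fin = finite_stage_law[OF gm t c]
  have k: "Suc (horizon D) - t = Suc ?k" "t + ?k \<le> horizon D" using t by auto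
  let ?v = "\<lambda>e. ?r e + run_value ?g ?k (Suc t) (?next e)"
  have "reward_to_go D ?g t c = measure_pmf.expectation (belief D t c)
      (\<lambda>(x, p0, p1). run_value ?g (Suc ?k) t (x, p0, p1, c))"
    by (simp add: reward_to_go_eq[OF g t c] k(1) full_belief_def case_prod_unfold)
  also have "\<dots> = measure_pmf.expectation (belief D t c) (\<lambda>(x, p0, p1).
      measure_pmf.expectation (gm t p0 c) (\<lambda>m. measure_pmf.expectation (noise_law D t)
        (\<lambda>n. ?v (x, p0, p1, m, n))))"
    using run_value_Suc[OF g t k(2) belief_in[OF t c]]
    by (intro expectation_cong_pmf) (auto simp del: transition.simps)
  also have "\<dots> = ?E ?v"
  proof -
    have fin_m: "finite (set_pmf (gm t p0 c))" if "(x, p0, p1) \<in> set_pmf (belief D t c)" for x p0 p1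
      using finite_message_law[OF g t belief_in[OF t c that]] by simp
    have "measure_pmf.expectation (map_pmf (\<lambda>(m, n). (x, p0, p1, m, n))
          (pair_pmf (gm t p0 c) (noise_law D t))) ?v =
        measure_pmf.expectation (gm t p0 c) (\<lambda>m. measure_pmf.expectation (noise_law D t)
          (\<lambda>n. ?v (x, p0, p1, m, n)))" if "(x, p0, p1) \<in> set_pmf (belief D t c)" for x p0 p1
      using fin_m[OF that] finite_noise_law[OF t]
      by (simp add: pair_pmf_def expectation_bind_pmf_finite del: transition.simps)
    moreover have "?E ?v = measure_pmf.expectation (belief D t c) (\<lambda>y. measure_pmf.expectation
        (case y of (x, p0, p1) \<Rightarrow> map_pmf (\<lambda>(m, n). (x, p0, p1, m, n))
          (pair_pmf (gm t p0 c) (noise_law D t))) ?v)"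
      unfolding stage_law_def using finite_belief[OF t c] finite_noise_law[OF t] fin_m
      by (intro expectation_bind_pmf_finite) auto
    ultimately show ?thesis
      by (auto intro!: expectation_cong_pmf simp del: transition.simps integral_map_pmf)
  qed
  also have "?E ?v = ?E ?r + ?E (\<lambda>e. run_value ?g ?k (Suc t) (?next e))"
    by (intro Bochner_Integration.integral_add integrable_measure_pmf_finite fin)
  also have "?E (\<lambda>e. run_value ?g ?k (Suc t) (?next e)) = ?E (\<lambda>e. ?J (common (?next e)))"
  \<comment> \<open>At the horizon no belief at \<open>Suc t\<close> is available, but both
    continuation values are 0.\<close>
  proof (cases "t = horizon D")
    case True
    then show ?thesis by (simp add: reward_to_go_after_horizon)
  next
    case False
    then have t': "t \<in> {1..<horizon D}" "Suc t \<in> {1..horizon D}" "Suc (horizon D) - Suc t = ?k"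
      using t by auto
    define \<nu> where "\<nu> = full_belief t c \<bind> info_kernel D ?g t"
    have map_\<nu>: "\<nu> = map_pmf ?next (stage_law gm t c)"
      unfolding \<nu>_def by (rule map_transition_stage_law[symmetric])
    note consistent = full_belief_bind_info_kernel[OF g t'(1) c, folded \<nu>_def]
    have fin_\<nu>: "finite (set_pmf (map_pmf common \<nu>))" using fin by (simp add: map_\<nu>)
    have "?E (\<lambda>e. run_value ?g ?k (Suc t) (?next e)) =
        measure_pmf.expectation \<nu> (run_value ?g ?k (Suc t))"
      unfolding map_\<nu> integral_map_pmf ..
    \<comment> \<open>Here the next information state is redrawn from the belief at its common
      part.\<close>
    also have "\<dots> = measure_pmf.expectation (map_pmf common \<nu> \<bind> full_belief (Suc t))
        (run_value ?g ?k (Suc t))"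
      using consistent(2) by (rule arg_cong)
    also have "\<dots> = measure_pmf.expectation (map_pmf common \<nu>)
        (\<lambda>c'. measure_pmf.expectation (full_belief (Suc t) c') (run_value ?g ?k (Suc t)))"
      using consistent(1) finite_belief[OF t'(2)]
      by (intro expectation_bind_pmf_finite fin_\<nu>) (auto simp: full_belief_def)
    also have "\<dots> = measure_pmf.expectation (map_pmf common \<nu>) ?J"
      using consistent(1) reward_to_go_eq[OF g t'(2)] unfolding t'(3)
      by (intro expectation_cong_pmf) auto
    also have "\<dots> = ?E (\<lambda>e. ?J (common (?next e)))"
      unfolding map_\<nu> integral_map_pmf ..
    finally show ?thesis .
  qed
  also have "?E ?r + ?E (\<lambda>e. ?J (common (?next e))) = ?E (\<lambda>e. ?r e + ?J (common (?next e)))"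
    by (intro Bochner_Integration.integral_add[symmetric] integrable_measure_pmf_finite fin)
  finally show ?thesis by (simp add: case_prod_unfold)
qed

lemma reward_to_go_cong_agent:
  assumes "t \<le> Suc (horizon D)" and "\<And>j. t \<le> j \<Longrightarrow> g1 j = g1' j"
  shows "reward_to_go D (gm, g0, g1) t c = reward_to_go D (gm, g0, g1') t c"
proof -
  have "noisy_run D (gm, g0, g1) k t = noisy_run D (gm, g0, g1') k t" for k
    using assms(2) by (intro ext noisy_run_cong_agent) auto
  then show ?thesis
    by (simp add: reward_to_go_def continuation_law_eq[OF assms(1)])
qed

section \<open>Sequential rationality and the one-stage inequalities\<close>

text \<open>The weights keep the joint probability of m and p1 instead of conditioning on them, so
  no division by a possibly zero probability occurs.\<close>

definition action_value ::
  "('m, 'p0, 'c, 'z) mstrategy \<Rightarrow> ('u0, 'p0, 'c, 'z) dstrategy \<Rightarrow> (('c, 'z) cinfo \<Rightarrow> real) \<Rightarrow>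
   nat \<Rightarrow> ('c, 'z) cinfo \<Rightarrow> 'm \<Rightarrow> 'p1 \<Rightarrow> 'u1 \<Rightarrow> real"
where
  "action_value gm h0 V t c m p1 u =
     (\<Sum>x\<in>states D t. \<Sum>p0\<in>dprivs D t. \<Sum>n\<in>noises D t.
        eta D gm t x p0 p1 m n c *
        (reward D t x (h0 t p0 c) u + V (Ext c (incr_upd D (Suc t) x p0 p1 (h0 t p0 c) u n))))"

text \<open>Summing over (p1, m) last separates the objective: within each inner sum the agent
  action is constant, so the actions at different (p1, m) can be optimised independently.\<close>

lemma expectation_stage_law_eq_action_value:
  assumes "gm \<in> mstrategies D" and "t \<in> {1..horizon D}" and "c \<in> possible_commons D t"
  shows "measure_pmf.expectation (stage_law gm t c) (\<lambda>(x, p0, p1, m, n).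
      reward D t x (h0 t p0 c) (g1 t m p1 c) +
      V (Ext c (incr_upd D (Suc t) x p0 p1 (h0 t p0 c) (g1 t m p1 c) n))) =
    (\<Sum>p1\<in>aprivs D t. \<Sum>m\<in>msgs D t. action_value gm h0 V t c m p1 (g1 t m p1 c))"
proof -
  define F where "F x p0 p1 m n = eta D gm t x p0 p1 m n c * (reward D t x (h0 t p0 c) (g1 t m p1 c) +
      V (Ext c (incr_upd D (Suc t) x p0 p1 (h0 t p0 c) (g1 t m p1 c) n)))" for x p0 p1 m n
  have "(\<Sum>x\<in>states D t. \<Sum>p0\<in>dprivs D t. \<Sum>p1\<in>aprivs D t. \<Sum>m\<in>msgs D t. \<Sum>n\<in>noises D t. F x p0 p1 m n) =
      (\<Sum>x\<in>states D t. \<Sum>p1\<in>aprivs D t. \<Sum>m\<in>msgs D t. \<Sum>p0\<in>dprivs D t. \<Sum>n\<in>noises D t. F x p0 p1 m n)"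
    by (intro sum.cong refl, subst sum.swap, intro sum.cong refl, rule sum.swap)
  also have "\<dots> = (\<Sum>p1\<in>aprivs D t. \<Sum>m\<in>msgs D t. \<Sum>x\<in>states D t. \<Sum>p0\<in>dprivs D t. \<Sum>n\<in>noises D t. F x p0 p1 m n)"
    by (subst sum.swap, intro sum.cong refl, rule sum.swap)
  finally show ?thesis
    unfolding expectation_stage_law[OF assms] by (simp add: F_def action_value_def)
qed

context
  fixes gm h0 h1
  assumes gm: "gm \<in> mstrategies D" and h0: "h0 \<in> dstrategies D" and h1: "h1 \<in> astrategies D"
begin

lemma profile: "g1 \<in> astrategies D \<Longrightarrow> (gm, h0, g1) \<in> profiles D"
  using gm h0 by (simp add: profiles_def)

lemma W_after_horizon: "W D gm h0 h1 (Suc (horizon D)) c = 0"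
  by (simp add: W.simps[of _ _ _ _ "Suc (horizon D)"])

lemma W_eq_action_value:
  assumes "t \<in> {1..horizon D}" and "c \<in> possible_commons D t"
  shows "W D gm h0 h1 t c =
    (\<Sum>p1\<in>aprivs D t. \<Sum>m\<in>msgs D t. action_value gm h0 (W D gm h0 h1 (Suc t)) t c m p1 (h1 t m p1 c))"
  using assms(1) unfolding expectation_stage_law_eq_action_value[OF gm assms, symmetric]
  by (subst expectation_stage_law[OF gm assms], subst W.simps) simp

lemma W_eq_reward_to_go:
  assumes "t \<in> {1..horizon D}" and "c \<in> possible_commons D t"
  shows "W D gm h0 h1 t c = reward_to_go D (gm, h0, h1) t c"
proof -
  have "W D gm h0 h1 t c = reward_to_go D (gm, h0, h1) t c"
    \<comment> \<open>Possibility of c is demanded only up to the horizon, so that the backward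
      induction can start at \<open>Suc (horizon D)\<close> with arbitrary c.\<close>
    if "t \<le> Suc (horizon D)" "1 \<le> t" "t \<le> horizon D \<Longrightarrow> c \<in> possible_commons D t" for t c
    using that
  proof (induction t arbitrary: c rule: inc_induct)
    case base
    then show ?case by (simp add: W_after_horizon reward_to_go_after_horizon)
  next
    case (step t)
    then have t: "t \<in> {1..horizon D}" and c: "c \<in> possible_commons D t" by auto
    have "W D gm h0 h1 t c = measure_pmf.expectation (stage_law gm t c)
        (\<lambda>(x, p0, p1, m, n). reward D t x (h0 t p0 c) (h1 t m p1 c) +
          W D gm h0 h1 (Suc t) (Ext c (incr_upd D (Suc t) x p0 p1 (h0 t p0 c) (h1 t m p1 c) n)))"
      unfolding expectation_stage_law_eq_action_value[OF gm t c] by (rule W_eq_action_value[OF t c])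
    also have "\<dots> = reward_to_go D (gm, h0, h1) t c"
      unfolding reward_to_go_recursion[OF profile[OF h1] t c]
      using Ext_possible[OF profile[OF h1] _ c] t
      by (intro expectation_cong_pmf) (auto intro!: step.IH)
    finally show ?case .
  qed
  then show ?thesis using assms by simp
qed

text \<open>Backward in time, the continuation of \<open>g1\<close> is first bounded by that of
  \<open>h1\<close>, which leaves a strategy differing from \<open>h1\<close> at stage t only;
  \<open>opt\<close> then applies to each (m, p1) separately.\<close>

lemma reward_to_go_le_W:
  assumes opt: "\<And>t c m p1 u. t \<in> {1..horizon D} \<Longrightarrow> c \<in> possible_commons D t \<Longrightarrow> m \<in> msgs D t \<Longrightarrow>
      p1 \<in> aprivs D t \<Longrightarrow> u \<in> aacts D t \<Longrightarrow>
      action_value gm h0 (W D gm h0 h1 (Suc t)) t c m p1 u \<le>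
      action_value gm h0 (W D gm h0 h1 (Suc t)) t c m p1 (h1 t m p1 c)"
    and g1: "g1 \<in> astrategies D"
    and "t \<in> {1..horizon D}" and "c \<in> possible_commons D t"
  shows "reward_to_go D (gm, h0, g1) t c \<le> W D gm h0 h1 t c"
proof -
  have "reward_to_go D (gm, h0, g1) t c \<le> W D gm h0 h1 t c"
    if "t \<le> Suc (horizon D)" "1 \<le> t" "t \<le> horizon D \<Longrightarrow> c \<in> possible_commons D t" for t c
    using that
  proof (induction t arbitrary: c rule: inc_induct)
    case base
    then show ?case by (simp add: W_after_horizon reward_to_go_after_horizon)
  next
    case (step t)
    then have t: "t \<in> {1..horizon D}" and c: "c \<in> possible_commons D t" by auto
    \<comment> \<open>Agent strategies are constrained only at formal values of the common
      information, so c must be shown to be one; any point in the support of the belief witnesses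
      this.\<close>
    obtain s where "s \<in> set_pmf (full_belief t c)" using set_pmf_not_empty[of "full_belief t c"] by blast
    then have c': "c \<in> commons D t"
      using full_belief_in[OF t c] by (auto simp: full_belief_def info_states_def)
    have "reward_to_go D (gm, h0, g1) t c \<le> measure_pmf.expectation (stage_law gm t c)
        (\<lambda>(x, p0, p1, m, n). reward D t x (h0 t p0 c) (g1 t m p1 c) +
          W D gm h0 h1 (Suc t) (Ext c (incr_upd D (Suc t) x p0 p1 (h0 t p0 c) (g1 t m p1 c) n)))"
      unfolding reward_to_go_recursion[OF profile[OF g1] t c]
      using Ext_possible[OF profile[OF g1] _ c] t
      by (intro expectation_mono_pmf finite_stage_law[OF gm t c]) (auto intro!: step.IH)
    also have "\<dots> = (\<Sum>p1\<in>aprivs D t. \<Sum>m\<in>msgs D t.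
        action_value gm h0 (W D gm h0 h1 (Suc t)) t c m p1 (g1 t m p1 c))"
      by (rule expectation_stage_law_eq_action_value[OF gm t c])
    also have "\<dots> \<le> W D gm h0 h1 t c"
      unfolding W_eq_action_value[OF t c] using g1 t c c'
      by (intro sum_mono opt) (auto simp: astrategies_def)
    finally show ?case .
  qed
  then show ?thesis using assms by simp
qed

text \<open>Rationality is assumed at every possible c, so it can be tested directly at (t, c). The
  deviation coincides with \<open>h1\<close> after t, hence its continuation value is
  \<open>W\<close>, and all summands other than the one at (m, p1) cancel.\<close>

lemma one_shot_deviation:
  assumes cisr: "CISR D gm h0 h1"
    and t: "t \<in> {1..horizon D}" and c: "c \<in> possible_commons D t" and m: "m \<in> msgs D t"
    and p1: "p1 \<in> aprivs D t" and u: "u \<in> aacts D t"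
  shows "action_value gm h0 (W D gm h0 h1 (Suc t)) t c m p1 u \<le>
    action_value gm h0 (W D gm h0 h1 (Suc t)) t c m p1 (h1 t m p1 c)"
proof -
  let ?A = "action_value gm h0 (W D gm h0 h1 (Suc t)) t c"
  define g1 where "g1 = h1(t := \<lambda>m' p1' c'. if m' = m \<and> p1' = p1 \<and> c' = c then u else h1 t m' p1' c')"
  have g1: "g1 \<in> astrategies D"
    using h1 u by (auto simp: g1_def astrategies_def)
  have later: "reward_to_go D (gm, h0, g1) (Suc t) c' = reward_to_go D (gm, h0, h1) (Suc t) c'" for c'
    using t by (intro reward_to_go_cong_agent) (auto simp: g1_def)
  have "reward_to_go D (gm, h0, g1) t c = measure_pmf.expectation (stage_law gm t c)
      (\<lambda>(x, p0, p1, m, n). reward D t x (h0 t p0 c) (g1 t m p1 c) +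
        W D gm h0 h1 (Suc t) (Ext c (incr_upd D (Suc t) x p0 p1 (h0 t p0 c) (g1 t m p1 c) n)))"
    unfolding reward_to_go_recursion[OF profile[OF g1] t c] later
  proof (rule expectation_cong_pmf, clarify)
    fix x p0 p1 m n assume e: "(x, p0, p1, m, n) \<in> set_pmf (stage_law gm t c)"
    let ?c = "Ext c (incr_upd D (Suc t) x p0 p1 (h0 t p0 c) (g1 t m p1 c) n)"
    have "reward_to_go D (gm, h0, h1) (Suc t) ?c = W D gm h0 h1 (Suc t) ?c"
    \<comment> \<open>\<open>?c\<close> is generated by the action of the deviation, so its
      possibility comes from the deviating profile, while the value attached to it is that of
      \<open>h1\<close>.\<close>
    proof (cases "t = horizon D")
      case True
      then show ?thesis by (simp add: W_after_horizon reward_to_go_after_horizon)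
    next
      case False
      then show ?thesis
        using t Ext_possible[OF profile[OF g1] _ c e] by (intro W_eq_reward_to_go[symmetric]) auto
    qed
    then show "reward D t x (h0 t p0 c) (g1 t m p1 c) + reward_to_go D (gm, h0, h1) (Suc t) ?c =
        reward D t x (h0 t p0 c) (g1 t m p1 c) + W D gm h0 h1 (Suc t) ?c" by simp
  qed
  also have "\<dots> = (\<Sum>p1'\<in>aprivs D t. \<Sum>m'\<in>msgs D t. ?A m' p1' (g1 t m' p1' c))"
    by (rule expectation_stage_law_eq_action_value[OF gm t c])
  finally have "(\<Sum>p1'\<in>aprivs D t. \<Sum>m'\<in>msgs D t. ?A m' p1' (g1 t m' p1' c)) =
      reward_to_go D (gm, h0, g1) t c" ..
  also have "\<dots> \<le> reward_to_go D (gm, h0, h1) t c"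
    using cisr t c g1 unfolding CISR_def by blast
  also have "\<dots> = (\<Sum>p1'\<in>aprivs D t. \<Sum>m'\<in>msgs D t. ?A m' p1' (h1 t m' p1' c))"
    unfolding W_eq_reward_to_go[OF t c, symmetric] by (rule W_eq_action_value[OF t c])
  finally have "0 \<le> (\<Sum>p1'\<in>aprivs D t. \<Sum>m'\<in>msgs D t.
      ?A m' p1' (h1 t m' p1' c) - ?A m' p1' (g1 t m' p1' c))"
    by (simp add: sum_subtractf)
  also have "\<dots> = (\<Sum>p1'\<in>aprivs D t. \<Sum>m'\<in>msgs D t. if m' = m then
      if p1' = p1 then ?A m p1 (h1 t m p1 c) - ?A m p1 u else 0 else 0)"
    by (intro sum.cong refl) (simp add: g1_def)
  also have "\<dots> = ?A m p1 (h1 t m p1 c) - ?A m p1 u"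
    using finite_sets[OF t] m p1 by (simp add: sum.delta)
  finally show ?thesis by simp
qed

end

end

theorem theorem1:
  fixes D :: "('x, 'u0, 'u1, 'n, 'm, 'p0, 'p1, 'c, 'z) problem"
    and gm :: "('m, 'p0, 'c, 'z) mstrategy"
    and h0 :: "('u0, 'p0, 'c, 'z) dstrategy"
    and h1 :: "('u1, 'm, 'p1, 'c, 'z) astrategy"
  assumes "wf_problem D"
    and "strategy_independent_beliefs D"
    and "initial_noise_consistent D"
    and "h0 \<in> dstrategies D" and "h1 \<in> astrategies D" and "gm \<in> mstrategies D"
  shows "CISR D gm h0 h1 \<longleftrightarrow>
    (\<forall>t\<in>{1..horizon D}. \<forall>c\<in>possible_commons D t. \<forall>m\<in>msgs D t. \<forall>p1\<in>aprivs D t. \<forall>u\<in>aacts D t.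
      (\<Sum>x\<in>states D t. \<Sum>p0\<in>dprivs D t. \<Sum>n\<in>noises D t.
         eta D gm t x p0 p1 m n c *
         (reward D t x (h0 t p0 c) (h1 t m p1 c) +
          W D gm h0 h1 (Suc t)
            (Ext c (incr_upd D (Suc t) x p0 p1 (h0 t p0 c) (h1 t m p1 c) n))))
      \<ge> (\<Sum>x\<in>states D t. \<Sum>p0\<in>dprivs D t. \<Sum>n\<in>noises D t.
         eta D gm t x p0 p1 m n c *
         (reward D t x (h0 t p0 c) u +
          W D gm h0 h1 (Suc t)
            (Ext c (incr_upd D (Suc t) x p0 p1 (h0 t p0 c) u n)))))"
proof -
  interpret belief_problem D
    using assms(1-3) by unfold_locales
  note strategies = assms(6,4,5)
  show ?thesis
    \<comment> \<open>Both sums become \<open>action_value\<close> with continuation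
      \<open>W\<close>, at the actions \<open>h1 t m p1 c\<close> and \<open>u\<close>.\<close>
    unfolding action_value_def[symmetric]
  proof (intro iffI ballI)
    fix t c m p1 u
    assume "CISR D gm h0 h1" "t \<in> {1..horizon D}" "c \<in> possible_commons D t" "m \<in> msgs D t"
      "p1 \<in> aprivs D t" "u \<in> aacts D t"
    then show "action_value gm h0 (W D gm h0 h1 (Suc t)) t c m p1 u \<le>
        action_value gm h0 (W D gm h0 h1 (Suc t)) t c m p1 (h1 t m p1 c)"
      by (rule one_shot_deviation[OF strategies])
  next
    assume opt: "\<forall>t\<in>{1..horizon D}. \<forall>c\<in>possible_commons D t. \<forall>m\<in>msgs D t. \<forall>p1\<in>aprivs D t.
      \<forall>u\<in>aacts D t. action_value gm h0 (W D gm h0 h1 (Suc t)) t c m p1 u \<le>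
        action_value gm h0 (W D gm h0 h1 (Suc t)) t c m p1 (h1 t m p1 c)"
    show "CISR D gm h0 h1"
      unfolding CISR_def
    proof (intro ballI)
      fix t c g1
      assume t: "t \<in> {1..horizon D}" and c: "c \<in> possible_commons D t" and g1: "g1 \<in> astrategies D"
      show "reward_to_go D (gm, h0, g1) t c \<le> reward_to_go D (gm, h0, h1) t c"
        unfolding W_eq_reward_to_go[OF strategies t c, symmetric]
        using opt by (intro reward_to_go_le_W[OF strategies _ g1 t c]) blast
    qed
  qed
qed

end
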